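(* Let $d\ge2$ and let $\mathcal{S}$ be a submodule of the Drury-Arveson module $H^2_d$ with $\Delta_{R_{\mathcal{S}}}<\infty$. Then the following are equivalent: (i) $\mathcal{S}$ is maximal. (ii) $(\mathbb{C}[z_1,\dots,z_d]\otimes\mathcal{D}_1)\cap\ker K(R_{\mathcal{S}})^*=\{0\}$.
   Context: $H^2_d$ is the Drury-Arveson space: the reproducing kernel Hilbert space of holomorphic functions on the unit ball $\mathbb{B}_d\subset\mathbb{C}^d$ with kernel $K_\lambda(z)=\bigl(1-\sum_{j=1}^dz_j\overline{\lambda_j}\bigr)^{-1}$, $\lambda,z\in\mathbb{B}_d$. $M_{z_i}$ is multiplication by the coordinate function $z_i$. A submodule of $H^2_d$ is a closed subspace $\mathcal{S}$ with $M_{z_i}\mathcal{S}\subseteq\mathcal{S}$ for $i=1,\dots,d$. Put $R_{\mathcal{S}}:=(M_{z_1}|_{\mathcal{S}},\dots,M_{z_d}|_{\mathcal{S}})$, a commuting contractive $d$-tuple on $\mathcal{S}$, where a $d$-tuple $T=(T_1,\dots,T_d)$ of operators is contractive if $\sum_iT_iT_i^*\le I$. For a contractive tuple $T$ let $\Psi_T(X)=\sum_{i=1}^dT_iXT_i^*$, $D_T:=(I-\Psi_T(I))^{1/2}$, and for $n\in\mathbb{N}=\{1,2,\dots\}$ let $\mathcal{D}_n:=\overline{\mathrm{ran}}(I-\Psi_T^n(I))$ and $\Delta_T^n:=\dim\mathcal{D}_n$ (the superscript on $\Delta$ is an index, not a power), $\Delta_T:=\Delta_T^1$. A commuting contractive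 $d$-tuple $T$ with $\Delta_T<\infty$ is maximal (on an infinite dimensional space) if $\Delta_T^n=\Bigl(\sum_{k=0}^{n-1}\binom{k+d-1}{d-1}\Bigr)\Delta_T$ for all $n\in\mathbb{N}$; the same identity is used as the definition for $\mathcal{S}=\{0\}$, where it holds trivially. The submodule $\mathcal{S}$ is maximal if the tuple $R_{\mathcal{S}}$ is maximal. In the claim $\mathcal{D}_1$ is the first defect space of $T=R_{\mathcal{S}}$, and $\mathbb{C}[z_1,\dots,z_d]\otimes\mathcal{D}_1$ is the algebraic tensor product, viewed inside $H^2_d\otimes\mathcal{D}_1$. The operator $K(R_{\mathcal{S}})^*:H^2_d\otimes\mathcal{D}_1\to H^2_d$ (adjoint of the Poisson kernel of $R_{\mathcal{S}}$) is the unique bounded linear operator with $K(R_{\mathcal{S}})^*(p\otimes\xi)=p\,D_{R_{\mathcal{S}}}\xi$ for $p\in\mathbb{C}[z_1,\dots,z_d]$ and $\xi\in\mathcal{D}_1$. *)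

theory Defs
  imports
    "HOL-Analysis.Analysis"
    "HOL-Library.Function_Algebras"
    "HOL-Library.Extended_Nat"
begin

section \<open>Complex vector spaces\<close>

class complex_vector = ab_group_add +
  fixes scaleC :: "complex \<Rightarrow> 'a \<Rightarrow> 'a"  (infixr "*\<^sub>C" 75)
  assumes scaleC_add_right: "a *\<^sub>C (x + y) = a *\<^sub>C x + a *\<^sub>C y"
    and scaleC_add_left: "(a + b) *\<^sub>C x = a *\<^sub>C x + b *\<^sub>C x"
    and scaleC_scaleC: "a *\<^sub>C b *\<^sub>C x = (a * b) *\<^sub>C x"
    and scaleC_one: "1 *\<^sub>C x = x"

global_interpretation complex_vector: vector_space "scaleC :: complex \<Rightarrow> 'a \<Rightarrow> 'a::complex_vector"
  defines csubspace = complex_vector.subspace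
    and cspan = complex_vector.span
    and cdependent = complex_vector.dependent
    and cdim = complex_vector.dim
  by unfold_locales (rule scaleC_add_right scaleC_add_left scaleC_scaleC scaleC_one)+

instantiation complex :: complex_vector
begin
definition scaleC_complex :: "complex \<Rightarrow> complex \<Rightarrow> complex"
  where "scaleC_complex a x = a * x"
instance
  by standard (auto simp: scaleC_complex_def algebra_simps)
end

instantiation "fun" :: (type, complex_vector) complex_vector
begin
definition scaleC_fun :: "complex \<Rightarrow> ('a \<Rightarrow> 'b) \<Rightarrow> 'a \<Rightarrow> 'b"
  where "scaleC_fun a f = (\<lambda>x. a *\<^sub>C f x)"
instance
  by standard
    (auto simp: scaleC_fun_def fun_eq_iff scaleC_add_right scaleC_add_left scaleC_scaleC scaleC_one)
end

text \<open>Since \<open>cdim\<close> is \<open>0\<close> for spaces without a finite basis, the dimension is taken in \<^typ>\<open>enat\<close>.\<close>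

definition edim :: "'v::complex_vector set \<Rightarrow> enat" where
  "edim M = (if \<exists>B. finite B \<and> M \<subseteq> cspan B then enat (cdim M) else \<infinity>)"


section \<open>Hilbert spaces with explicit carrier\<close>

text \<open>The inner product is only meaningful on the carrier. A subspace \<open>M\<close> with the inherited inner
  product is \<open>V\<lparr>elts := M\<rparr>\<close>.\<close>

record 'v ip_space =
  elts :: "'v set"
  ip :: "'v \<Rightarrow> 'v \<Rightarrow> complex"

definition is_ip_space :: "'v::complex_vector ip_space \<Rightarrow> bool" where
  "is_ip_space V \<longleftrightarrow>
     csubspace (elts V) \<and>
     (\<forall>x\<in>elts V. \<forall>y\<in>elts V. \<forall>z\<in>elts V. ip V (x + y) z = ip V x z + ip V y z) \<and>
     (\<forall>x\<in>elts V. \<forall>z\<in>elts V. \<forall>a. ip V (a *\<^sub>C x) z = a * ip V x z) \<and>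
     (\<forall>x\<in>elts V. \<forall>y\<in>elts V. ip V y x = cnj (ip V x y)) \<and>
     (\<forall>x\<in>elts V. x \<noteq> 0 \<longrightarrow> Re (ip V x x) > 0)"

definition nrm :: "'v ip_space \<Rightarrow> 'v \<Rightarrow> real" where
  "nrm V x = sqrt (Re (ip V x x))"

definition tends :: "'v::complex_vector ip_space \<Rightarrow> (nat \<Rightarrow> 'v) \<Rightarrow> 'v \<Rightarrow> bool" where
  "tends V s l \<longleftrightarrow> (\<lambda>n. nrm V (s n - l)) \<longlonglongrightarrow> 0"

definition is_hilbert_space :: "'v::complex_vector ip_space \<Rightarrow> bool" where
  "is_hilbert_space V \<longleftrightarrow>
     is_ip_space V \<and>
     (\<forall>s. range s \<subseteq> elts V \<and> (\<forall>e>0. \<exists>N. \<forall>m\<ge>N. \<forall>n\<ge>N. nrm V (s m - s n) < e) \<longrightarrow>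
        (\<exists>l\<in>elts V. tends V s l))"

definition closure_in :: "'v::complex_vector ip_space \<Rightarrow> 'v set \<Rightarrow> 'v set" where
  "closure_in V M = {x \<in> elts V. \<exists>s. range s \<subseteq> M \<and> tends V s x}"

definition closed_csubspace :: "'v::complex_vector ip_space \<Rightarrow> 'v set \<Rightarrow> bool" where
  "closed_csubspace V M \<longleftrightarrow> csubspace M \<and> M \<subseteq> elts V \<and> closure_in V M = M"

definition bounded_op ::
  "'v::complex_vector ip_space \<Rightarrow> 'w::complex_vector ip_space \<Rightarrow> ('v \<Rightarrow> 'w) \<Rightarrow> bool" where
  "bounded_op V W A \<longleftrightarrow>
     (\<forall>x\<in>elts V. A x \<in> elts W) \<and>
     (\<forall>x\<in>elts V. \<forall>y\<in>elts V. A (x + y) = A x + A y) \<and>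
     (\<forall>x\<in>elts V. \<forall>a. A (a *\<^sub>C x) = a *\<^sub>C A x) \<and>
     (\<exists>B. \<forall>x\<in>elts V. nrm W (A x) \<le> B * nrm V x)"

text \<open>The choices in the next definition, in \<open>defect_op\<close> and in \<open>poisson_adj\<close> below are unique on the
  carrier of the space in question.\<close>

definition adj :: "'v ip_space \<Rightarrow> 'w ip_space \<Rightarrow> ('v \<Rightarrow> 'w) \<Rightarrow> 'w \<Rightarrow> 'v" where
  "adj V W A y = (SOME x. x \<in> elts V \<and> (\<forall>u\<in>elts V. ip W (A u) y = ip V u x))"

definition positive_op :: "'v::complex_vector ip_space \<Rightarrow> ('v \<Rightarrow> 'v) \<Rightarrow> bool" where
  "positive_op V A \<longleftrightarrow> bounded_op V V A \<and> (\<forall>x\<in>elts V. ip V (A x) x \<in> nonneg_Reals)"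

text \<open>\<open>tens\<close> exhibits \<open>U\<close> as the Hilbert space tensor product of \<open>V\<close> and \<open>W\<close>, which is
  determined by these conditions up to a unique unitary respecting elementary tensors.\<close>

definition is_hilbert_tensor ::
  "'v::complex_vector ip_space \<Rightarrow> 'w::complex_vector ip_space \<Rightarrow> 'u::complex_vector ip_space \<Rightarrow>
   ('v \<Rightarrow> 'w \<Rightarrow> 'u) \<Rightarrow> bool" where
  "is_hilbert_tensor V W U tens \<longleftrightarrow>
     is_hilbert_space U \<and>
     (\<forall>f\<in>elts V. \<forall>x\<in>elts W. tens f x \<in> elts U) \<and>
     (\<forall>f\<in>elts V. \<forall>g\<in>elts V. \<forall>x\<in>elts W. tens (f + g) x = tens f x + tens g x) \<and>
     (\<forall>f\<in>elts V. \<forall>x\<in>elts W. \<forall>y\<in>elts W. tens f (x + y) = tens f x + tens f y) \<and>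
     (\<forall>f\<in>elts V. \<forall>x\<in>elts W. \<forall>a. tens (a *\<^sub>C f) x = a *\<^sub>C tens f x \<and> tens f (a *\<^sub>C x) = a *\<^sub>C tens f x) \<and>
     (\<forall>f\<in>elts V. \<forall>g\<in>elts V. \<forall>x\<in>elts W. \<forall>y\<in>elts W.
        ip U (tens f x) (tens g y) = ip V f g * ip W x y) \<and>
     closure_in U (cspan {tens f x | f x. f \<in> elts V \<and> x \<in> elts W}) = elts U"


section \<open>Contractive tuples and their defect spaces\<close>

definition Psi :: "'v::complex_vector ip_space \<Rightarrow> ('d::finite \<Rightarrow> 'v \<Rightarrow> 'v) \<Rightarrow> ('v \<Rightarrow> 'v) \<Rightarrow> 'v \<Rightarrow> 'v" where
  "Psi V T X = (\<lambda>x. \<Sum>i\<in>UNIV. T i (X (adj V V (T i) x)))"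

definition commuting_tuple :: "'v ip_space \<Rightarrow> ('d::finite \<Rightarrow> 'v \<Rightarrow> 'v) \<Rightarrow> bool" where
  "commuting_tuple V T \<longleftrightarrow> (\<forall>i j. \<forall>x\<in>elts V. T i (T j x) = T j (T i x))"

definition contractive_tuple :: "'v::complex_vector ip_space \<Rightarrow> ('d::finite \<Rightarrow> 'v \<Rightarrow> 'v) \<Rightarrow> bool" where
  "contractive_tuple V T \<longleftrightarrow>
     (\<forall>i. bounded_op V V (T i)) \<and> positive_op V (\<lambda>x. x - Psi V T id x)"

definition defect_op :: "'v::complex_vector ip_space \<Rightarrow> ('d::finite \<Rightarrow> 'v \<Rightarrow> 'v) \<Rightarrow> 'v \<Rightarrow> 'v" where
  "defect_op V T = (SOME D. positive_op V D \<and> (\<forall>x\<in>elts V. D (D x) = x - Psi V T id x))"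

definition defect_space ::
  "'v::complex_vector ip_space \<Rightarrow> ('d::finite \<Rightarrow> 'v \<Rightarrow> 'v) \<Rightarrow> nat \<Rightarrow> 'v set" where
  "defect_space V T n = closure_in V ((\<lambda>x. x - (Psi V T ^^ n) id x) ` elts V)"

definition Delta :: "'v::complex_vector ip_space \<Rightarrow> ('d::finite \<Rightarrow> 'v \<Rightarrow> 'v) \<Rightarrow> nat \<Rightarrow> enat" where
  "Delta V T n = edim (defect_space V T n)"

text \<open>Maximality is considered for tuples on infinite dimensional spaces and on \<open>{0}\<close>, which covers all
  submodules of the Drury-Arveson space, since the nonzero ones are infinite dimensional.\<close>

definition maximal_tuple :: "'v::complex_vector ip_space \<Rightarrow> ('d::finite \<Rightarrow> 'v \<Rightarrow> 'v) \<Rightarrow> bool" where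
  "maximal_tuple V T \<longleftrightarrow>
     commuting_tuple V T \<and> contractive_tuple V T \<and> Delta V T 1 < \<infinity> \<and>
     (\<forall>n\<ge>1. Delta V T n =
        of_nat (\<Sum>k<n. (k + CARD('d) - 1) choose (CARD('d) - 1)) * Delta V T 1)"


section \<open>The Drury-Arveson space\<close>

typedef (overloaded) ('d::finite) unit_ball = "ball 0 1 :: (complex ^ 'd) set"
  morphisms vec_of to_ball
  by (rule exI[of _ 0]) simp

definition holomorphic_ball :: "('d::finite unit_ball \<Rightarrow> complex) \<Rightarrow> bool" where
  "holomorphic_ball f \<longleftrightarrow>
     (\<forall>z\<in>ball 0 1. \<exists>f'. ((\<lambda>w. f (to_ball w)) has_derivative f') (at z) \<and> (\<forall>c v. f' (c *s v) = c * f' v))"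

definition is_rkhs :: "('x \<Rightarrow> 'x \<Rightarrow> complex) \<Rightarrow> ('x \<Rightarrow> complex) ip_space \<Rightarrow> bool" where
  "is_rkhs K H \<longleftrightarrow>
     is_hilbert_space H \<and>
     (\<forall>l. K l \<in> elts H \<and> (\<forall>f\<in>elts H. ip H f (K l) = f l))"

definition DA_kernel :: "'d::finite unit_ball \<Rightarrow> 'd unit_ball \<Rightarrow> complex" where
  "DA_kernel l z = inverse (1 - (\<Sum>j\<in>UNIV. vec_of z $ j * cnj (vec_of l $ j)))"

text \<open>The space is determined by its kernel; holomorphy of the elements is in fact automatic.\<close>

definition is_drury_arveson :: "('d::finite unit_ball \<Rightarrow> complex) ip_space \<Rightarrow> bool" where
  "is_drury_arveson H \<longleftrightarrow> is_rkhs DA_kernel H \<and> (\<forall>f\<in>elts H. holomorphic_ball f)"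

definition Mz :: "'d::finite \<Rightarrow> ('d unit_ball \<Rightarrow> complex) \<Rightarrow> 'd unit_ball \<Rightarrow> complex" where
  "Mz i f = (\<lambda>z. vec_of z $ i * f z)"

definition submodule ::
  "('d::finite unit_ball \<Rightarrow> complex) ip_space \<Rightarrow> ('d unit_ball \<Rightarrow> complex) set \<Rightarrow> bool" where
  "submodule H S \<longleftrightarrow> closed_csubspace H S \<and> (\<forall>i. \<forall>f\<in>S. Mz i f \<in> S)"

definition maximal_submodule ::
  "('d::finite unit_ball \<Rightarrow> complex) ip_space \<Rightarrow> ('d unit_ball \<Rightarrow> complex) set \<Rightarrow> bool" where
  "maximal_submodule H S \<longleftrightarrow> maximal_tuple (H\<lparr>elts := S\<rparr>) Mz"

text \<open>Polynomials are identified with the functions they define on the ball.\<close>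

definition polys :: "('d::finite unit_ball \<Rightarrow> complex) set" where
  "polys = cspan (range (\<lambda>(a :: 'd \<Rightarrow> nat) z. \<Prod>i\<in>UNIV. (vec_of z $ i) ^ a i))"

text \<open>\<open>U\<close> with \<open>tens\<close> is a tensor product of \<open>H\<close> with the first defect space of the tuple on \<open>S\<close>.
  The product \<open>p * g\<close> of functions is pointwise.\<close>

definition poisson_adj ::
  "('d::finite unit_ball \<Rightarrow> complex) ip_space \<Rightarrow> ('d unit_ball \<Rightarrow> complex) set \<Rightarrow>
   'u::complex_vector ip_space \<Rightarrow>
   (('d unit_ball \<Rightarrow> complex) \<Rightarrow> ('d unit_ball \<Rightarrow> complex) \<Rightarrow> 'u) \<Rightarrow>
   'u \<Rightarrow> 'd unit_ball \<Rightarrow> complex" where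
  "poisson_adj H S U tens = (SOME A. bounded_op U H A \<and>
     (\<forall>p\<in>polys. \<forall>x\<in>defect_space (H\<lparr>elts := S\<rparr>) Mz 1.
        A (tens p x) = p * defect_op (H\<lparr>elts := S\<rparr>) Mz x))"

end

(*
  Everything is done with reproducing kernels. If k and K are the kernels of S and H, E is an
  orthonormal basis of the first defect space and D the defect operator, then
    k_l(m) = (sum_{e in E} cnj (D e l) * D e m) * K_l(m),
  which makes p (x) v |-> p * D v a bounded map from H (x) D1 to S, D1 being the first defect space.
  On the other side, I - Psi^n(I) is a sum of squares whose range closure is spanned by the products z^a * D e with |a| < n and e in E. There are
  (sum_{k<n} binomial(k+d-1, d-1)) * card E such products, so S is maximal iff for every n they are linearly
  independent, i.e. iff the map above is injective on polynomials with values in D1.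
*)
theory Submission
  imports Defs "HOL-Computational_Algebra.Fundamental_Theorem_Algebra"
begin

section \<open>Inner product spaces with explicit carrier\<close>

text \<open>Both \<open>defect_op\<close> and \<open>poisson_adj\<close> are chosen by
  \<open>SOME\<close>, so nothing is known about them until an operator with the required properties
  has been produced; these two existence proofs shape the argument. A square root of
  \<open>I - Psi(I)\<close> would in general call for functional calculus, but finite defect makes
  the range of this operator finite dimensional, and diagonalisation is enough. For the Poisson map,
  the kernel factorization turns boundedness into an equality of two Gram matrices.

  Contractivity of the coordinate multiplications comes from the identity
  \<open>(1 - <m,l>) K_l(m) = 1\<close>: a difference of squared norms becomes the squared modulus
  of a single sum. Norms of monomials are never computed. Independence of monomials is obtained from
  polynomial functions on the ball, and independence of the tensors \<open>z^a (x) e\<close> from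
  testing a relation against suitable vectors. Only the latter allows kernel elements of the Poisson
  map to be read as relations among the products \<open>z^a * D e\<close>.\<close>

locale ips =
  fixes V :: "'v::complex_vector ip_space"
  assumes ips: "is_ip_space V"
begin

lemma subspace_elts: "csubspace (elts V)"
  using ips by (simp add: is_ip_space_def)

lemma zero_in [simp]: "0 \<in> elts V"
  using subspace_elts by (rule complex_vector.subspace_0)

lemma add_in [simp]: "x \<in> elts V \<Longrightarrow> y \<in> elts V \<Longrightarrow> x + y \<in> elts V"
  using subspace_elts by (rule complex_vector.subspace_add)

lemma diff_in [simp]: "x \<in> elts V \<Longrightarrow> y \<in> elts V \<Longrightarrow> x - y \<in> elts V"
  using subspace_elts by (rule complex_vector.subspace_diff)

lemma scale_in [simp]: "x \<in> elts V \<Longrightarrow> a *\<^sub>C x \<in> elts V"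
  using subspace_elts by (rule complex_vector.subspace_scale)

lemma sum_in: "(\<And>i. i \<in> I \<Longrightarrow> f i \<in> elts V) \<Longrightarrow> (\<Sum>i\<in>I. f i) \<in> elts V"
  using subspace_elts by (rule complex_vector.subspace_sum)

lemma ip_add_left: "x \<in> elts V \<Longrightarrow> y \<in> elts V \<Longrightarrow> z \<in> elts V \<Longrightarrow> ip V (x + y) z = ip V x z + ip V y z"
  using ips unfolding is_ip_space_def by metis

lemma ip_scale_left: "x \<in> elts V \<Longrightarrow> z \<in> elts V \<Longrightarrow> ip V (a *\<^sub>C x) z = a * ip V x z"
  using ips unfolding is_ip_space_def by metis

lemma ip_sym: "x \<in> elts V \<Longrightarrow> y \<in> elts V \<Longrightarrow> ip V y x = cnj (ip V x y)"
  using ips unfolding is_ip_space_def by metis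

lemma ip_pos: "x \<in> elts V \<Longrightarrow> x \<noteq> 0 \<Longrightarrow> Re (ip V x x) > 0"
  using ips unfolding is_ip_space_def by metis

lemma ip_add_right: "x \<in> elts V \<Longrightarrow> y \<in> elts V \<Longrightarrow> z \<in> elts V \<Longrightarrow> ip V x (y + z) = ip V x y + ip V x z"
  using ip_sym[of "y + z" x] ip_sym[of y x] ip_sym[of z x] by (simp add: ip_add_left)

lemma ip_scale_right: "x \<in> elts V \<Longrightarrow> z \<in> elts V \<Longrightarrow> ip V x (a *\<^sub>C z) = cnj a * ip V x z"
  using ip_sym[of "a *\<^sub>C z" x] ip_sym[of z x] by (simp add: ip_scale_left)

lemma ip_zero_left [simp]: "z \<in> elts V \<Longrightarrow> ip V 0 z = 0"
  using ip_scale_left[of 0 z 0] by simp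

lemma ip_zero_right [simp]: "z \<in> elts V \<Longrightarrow> ip V z 0 = 0"
  using ip_scale_right[of z 0 0] by simp

lemma ip_diff_left: "x \<in> elts V \<Longrightarrow> y \<in> elts V \<Longrightarrow> z \<in> elts V \<Longrightarrow> ip V (x - y) z = ip V x z - ip V y z"
  using ip_add_left[of "x - y" y z] by simp

lemma ip_diff_right: "x \<in> elts V \<Longrightarrow> y \<in> elts V \<Longrightarrow> z \<in> elts V \<Longrightarrow> ip V x (y - z) = ip V x y - ip V x z"
  using ip_add_right[of x "y - z" z] by simp

lemma ip_sum_left:
  "(\<And>i. i \<in> I \<Longrightarrow> f i \<in> elts V) \<Longrightarrow> z \<in> elts V \<Longrightarrow> ip V (\<Sum>i\<in>I. f i) z = (\<Sum>i\<in>I. ip V (f i) z)"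
  by (induction I rule: infinite_finite_induct) (auto simp: ip_add_left sum_in)

lemma ip_sum_right:
  "(\<And>i. i \<in> I \<Longrightarrow> f i \<in> elts V) \<Longrightarrow> z \<in> elts V \<Longrightarrow> ip V z (\<Sum>i\<in>I. f i) = (\<Sum>i\<in>I. ip V z (f i))"
  by (induction I rule: infinite_finite_induct) (auto simp: ip_add_right sum_in)

lemma Re_ip_self_nonneg: "x \<in> elts V \<Longrightarrow> Re (ip V x x) \<ge> 0"
  using ip_pos[of x] by (cases "x = 0") auto

lemma nrm_nonneg [simp]: "x \<in> elts V \<Longrightarrow> nrm V x \<ge> 0"
  by (simp add: nrm_def Re_ip_self_nonneg)

lemma nrm_sq: "x \<in> elts V \<Longrightarrow> (nrm V x)\<^sup>2 = Re (ip V x x)"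
  by (simp add: nrm_def Re_ip_self_nonneg)

lemma ip_self: "x \<in> elts V \<Longrightarrow> ip V x x = of_real ((nrm V x)\<^sup>2)"
  using arg_cong[OF ip_sym[of x x], of Im] by (simp add: nrm_sq complex_eq_iff)

lemma nrm_zero [simp]: "nrm V 0 = 0"
  by (simp add: nrm_def)

lemma nrm_eq_0: "x \<in> elts V \<Longrightarrow> nrm V x = 0 \<longleftrightarrow> x = 0"
  using ip_pos[of x] nrm_sq[of x] by (cases "x = 0") auto

lemma ip_self_eq_0: "x \<in> elts V \<Longrightarrow> ip V x x = 0 \<longleftrightarrow> x = 0"
  by (simp add: ip_self nrm_eq_0)

lemma nrm_add_sq:
  "x \<in> elts V \<Longrightarrow> y \<in> elts V \<Longrightarrow> (nrm V (x + y))\<^sup>2 = (nrm V x)\<^sup>2 + (nrm V y)\<^sup>2 + 2 * Re (ip V x y)"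
  using ip_sym[of x y] by (simp add: nrm_sq ip_add_left ip_add_right)

lemma nrm_diff_sq:
  "x \<in> elts V \<Longrightarrow> y \<in> elts V \<Longrightarrow> (nrm V (x - y))\<^sup>2 = (nrm V x)\<^sup>2 + (nrm V y)\<^sup>2 - 2 * Re (ip V x y)"
  using ip_sym[of x y] by (simp add: nrm_sq ip_diff_left ip_diff_right)

lemma nrm_scale: "x \<in> elts V \<Longrightarrow> nrm V (a *\<^sub>C x) = cmod a * nrm V x"
proof -
  assume x: "x \<in> elts V"
  have "(nrm V (a *\<^sub>C x))\<^sup>2 = (cmod a * nrm V x)\<^sup>2"
  proof -
    have "ip V (a *\<^sub>C x) (a *\<^sub>C x) = (a * cnj a) * ip V x x"
      using x by (simp add: ip_scale_left ip_scale_right)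
    also have "\<dots> = (a * cnj a) * of_real ((nrm V x)\<^sup>2)"
      using x by (simp add: ip_self)
    also have "\<dots> = of_real ((cmod a * nrm V x)\<^sup>2)"
      by (simp add: complex_mult_cnj cmod_power2 power_mult_distrib)
    finally show ?thesis
      using x nrm_sq[of "a *\<^sub>C x"] by simp
  qed
  then show ?thesis
    using x by (simp add: power2_eq_iff_nonneg)
qed

lemma Cauchy_Schwarz:
  assumes x: "x \<in> elts V" and y: "y \<in> elts V"
  shows "cmod (ip V x y) \<le> nrm V x * nrm V y"
proof (cases "y = 0")
  case False
  define n where "n = (nrm V y)\<^sup>2"
  define w where "w = ip V x y"
  have n: "n > 0"
    using False y nrm_eq_0[of y] by (simp add: n_def)
  \<comment> \<open>With this \<open>c\<close> the vector \<open>c *\<^sub>C y\<close> is the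
    projection of \<open>x\<close> onto the line of \<open>y\<close>, which makes the square below
    as small as possible.\<close>
  define c where "c = w / of_real n"
  have "0 \<le> (nrm V (x - c *\<^sub>C y))\<^sup>2"
    by simp
  also have "\<dots> = (nrm V x)\<^sup>2 + (cmod c)\<^sup>2 * n - 2 * Re (cnj c * w)"
    using x y by (simp add: nrm_diff_sq nrm_scale n_def w_def ip_scale_right power_mult_distrib)
  also have "cnj c * w = of_real ((cmod w)\<^sup>2 / n)"
    by (simp add: c_def complex_norm_square mult.commute del: of_real_power)
  also have "Re (of_real ((cmod w)\<^sup>2 / n)) = (cmod w)\<^sup>2 / n"
    by (rule Re_complex_of_real)
  also have "(cmod c)\<^sup>2 * n = (cmod w)\<^sup>2 / n"
    using n by (simp add: c_def norm_divide power2_eq_square)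
  finally have "(cmod w)\<^sup>2 \<le> (nrm V x)\<^sup>2 * n"
    using n by (simp add: field_simps)
  then have "(cmod w)\<^sup>2 \<le> (nrm V x * nrm V y)\<^sup>2"
    by (simp add: n_def power_mult_distrib)
  then show ?thesis
    using x y by (simp add: w_def power2_le_iff_abs_le)
qed (use x in simp)

lemma nrm_triangle: "x \<in> elts V \<Longrightarrow> y \<in> elts V \<Longrightarrow> nrm V (x + y) \<le> nrm V x + nrm V y"
proof (rule power2_le_imp_le)
  assume *: "x \<in> elts V" "y \<in> elts V"
  have "Re (ip V x y) \<le> nrm V x * nrm V y"
    using Cauchy_Schwarz[OF *] complex_Re_le_cmod order_trans by blast
  then show "(nrm V (x + y))\<^sup>2 \<le> (nrm V x + nrm V y)\<^sup>2"
    using * by (simp add: nrm_add_sq power2_sum)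
qed simp

lemma tends_ip:
  assumes s: "\<And>n. s n \<in> elts V" and l: "l \<in> elts V" and y: "y \<in> elts V" and t: "tends V s l"
  shows "(\<lambda>n. ip V (s n) y) \<longlonglongrightarrow> ip V l y"
proof -
  have lim: "(\<lambda>n. nrm V (s n - l) * nrm V y) \<longlonglongrightarrow> 0"
    using tendsto_mult_left_zero t unfolding tends_def by blast
  have le: "cmod (ip V (s n) y - ip V l y) \<le> nrm V (s n - l) * nrm V y" for n
    using Cauchy_Schwarz[of "s n - l" y] s l y by (simp add: ip_diff_left)
  have "(\<lambda>n. ip V (s n) y - ip V l y) \<longlonglongrightarrow> 0"
    by (rule Lim_null_comparison[OF always_eventually lim]) (rule allI, rule le)
  then show ?thesis
    by (simp add: LIM_zero_iff)
qed

lemma ip_closure_eq_0: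
  assumes M: "M \<subseteq> elts V" and x: "x \<in> closure_in V M" and y: "y \<in> elts V"
    and "\<And>h. h \<in> M \<Longrightarrow> ip V h y = 0"
  shows "ip V x y = 0"
proof -
  obtain s where s: "range s \<subseteq> M" "tends V s x" and "x \<in> elts V"
    using x by (auto simp: closure_in_def)
  then have "(\<lambda>n. ip V (s n) y) \<longlonglongrightarrow> ip V x y"
    using M y by (intro tends_ip) auto
  moreover have "(\<lambda>n. ip V (s n) y) = (\<lambda>n. 0)"
    using s assms(4) by auto
  ultimately show ?thesis
    by (simp add: LIMSEQ_const_iff)
qed

lemma closure_in_elts: "closure_in V M \<subseteq> elts V"
  by (auto simp: closure_in_def)

lemma subset_closure_in: "M \<subseteq> elts V \<Longrightarrow> M \<subseteq> closure_in V M"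
proof
  fix x assume "M \<subseteq> elts V" "x \<in> M"
  then show "x \<in> closure_in V M"
    unfolding closure_in_def tends_def by (auto intro!: exI[of _ "\<lambda>_. x"])
qed

lemma subspace_closure_in:
  assumes "csubspace M" "M \<subseteq> elts V"
  shows "csubspace (closure_in V M)"
proof (rule complex_vector.subspaceI)
  show "0 \<in> closure_in V M"
    using assms subset_closure_in complex_vector.subspace_0 by blast
next
  fix x y assume "x \<in> closure_in V M" "y \<in> closure_in V M"
  then obtain s t where s: "range s \<subseteq> M" "tends V s x" "x \<in> elts V"
    and t: "range t \<subseteq> M" "tends V t y" "y \<in> elts V"
    by (auto simp: closure_in_def)
  have lim: "(\<lambda>n. nrm V (s n - x) + nrm V (t n - y)) \<longlonglongrightarrow> 0"
    using s t by (intro tendsto_eq_intros) (auto simp: tends_def)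
  have st: "s n \<in> elts V" "t n \<in> elts V" for n
    using s t assms by auto
  have le: "norm (nrm V (s n + t n - (x + y))) \<le> nrm V (s n - x) + nrm V (t n - y)" for n
    using nrm_triangle[of "s n - x" "t n - y"] st s t by (simp add: add_diff_add)
  have "(\<lambda>n. nrm V (s n + t n - (x + y))) \<longlonglongrightarrow> 0"
    by (rule Lim_null_comparison[OF always_eventually lim]) (rule allI, rule le)
  then have "tends V (\<lambda>n. s n + t n) (x + y)"
    by (simp add: tends_def)
  moreover have "range (\<lambda>n. s n + t n) \<subseteq> M"
    using s t complex_vector.subspace_add[OF assms(1)] by auto
  ultimately show "x + y \<in> closure_in V M"
    using s t by (auto simp: closure_in_def)
next
  fix x c assume "x \<in> closure_in V M"
  then obtain s where s: "range s \<subseteq> M" "tends V s x" "x \<in> elts V"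
    by (auto simp: closure_in_def)
  have "s n \<in> elts V" for n
    using s assms by auto
  then have "nrm V (c *\<^sub>C s n - c *\<^sub>C x) = cmod c * nrm V (s n - x)" for n
    using s by (simp add: nrm_scale flip: complex_vector.scale_right_diff_distrib)
  moreover have "(\<lambda>n. cmod c * nrm V (s n - x)) \<longlonglongrightarrow> 0"
    using s by (intro tendsto_eq_intros) (auto simp: tends_def)
  ultimately have "tends V (\<lambda>n. c *\<^sub>C s n) (c *\<^sub>C x)"
    by (simp add: tends_def)
  moreover have "range (\<lambda>n. c *\<^sub>C s n) \<subseteq> M"
    using s complex_vector.subspace_scale[OF assms(1)] by auto
  ultimately show "c *\<^sub>C x \<in> closure_in V M"
    using s by (auto simp: closure_in_def)
qed

lemma restrict:
  assumes "csubspace M" "M \<subseteq> elts V"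
  shows "ips (V\<lparr>elts := M\<rparr>)"
proof -
  have M: "x \<in> elts V" if "x \<in> M" for x
    using that assms by blast
  show ?thesis
    unfolding ips_def is_ip_space_def
    by (simp add: assms(1) M ip_add_left ip_scale_left ip_pos) (meson M ip_sym)
qed

end

locale hilbert = ips +
  assumes hilbert: "is_hilbert_space V"

lemma hilbertI: "is_hilbert_space V \<Longrightarrow> hilbert V"
  by (simp add: hilbert_def ips_def hilbert_axioms_def is_hilbert_space_def)

lemma nrm_elts_update [simp]: "nrm (V\<lparr>elts := M\<rparr>) = nrm V"
  by (simp add: nrm_def fun_eq_iff)

lemma tends_elts_update [simp]: "tends (V\<lparr>elts := M\<rparr>) = tends V"
  by (simp add: tends_def fun_eq_iff)

context hilbert
begin

lemma restrict_closed:
  assumes "closed_csubspace V M"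
  shows "hilbert (V\<lparr>elts := M\<rparr>)"
proof (rule hilbertI)
  have M: "csubspace M" "M \<subseteq> elts V" "closure_in V M = M"
    using assms by (auto simp: closed_csubspace_def)
  show "is_hilbert_space (V\<lparr>elts := M\<rparr>)"
    unfolding is_hilbert_space_def
  proof (intro conjI allI impI)
    show "is_ip_space (V\<lparr>elts := M\<rparr>)"
      using restrict[OF M(1,2)] by (simp add: ips_def)
    fix s :: "nat \<Rightarrow> 'a"
    assume s: "range s \<subseteq> elts (V\<lparr>elts := M\<rparr>) \<and>
      (\<forall>e>0. \<exists>N. \<forall>m\<ge>N. \<forall>n\<ge>N. nrm (V\<lparr>elts := M\<rparr>) (s m - s n) < e)"
    then have "range s \<subseteq> elts V \<and> (\<forall>e>0. \<exists>N. \<forall>m\<ge>N. \<forall>n\<ge>N. nrm V (s m - s n) < e)"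
      using M by auto
    then obtain l where "l \<in> elts V" "tends V s l"
      using hilbert unfolding is_hilbert_space_def by blast
    then have "l \<in> closure_in V M"
      using s by (auto simp: closure_in_def)
    then show "\<exists>l\<in>elts (V\<lparr>elts := M\<rparr>). tends (V\<lparr>elts := M\<rparr>) s l"
      using M \<open>tends V s l\<close> by auto
  qed
qed

text \<open>A functional on a subspace is given by its graph \<open>G\<close>, so that no well-definedness is needed when
  it is prescribed on a spanning family.\<close>

lemma Riesz_graph:
  assumes C: "C \<ge> 0" and G0: "G 0 0"
    and Gadd: "\<And>h z h' z'. G h z \<Longrightarrow> G h' z' \<Longrightarrow> G (h + h') (z + z')"
    and Gscale: "\<And>h z a. G h z \<Longrightarrow> G (a *\<^sub>C h) (a * z)"
    and Gin: "\<And>h z. G h z \<Longrightarrow> h \<in> elts V"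
    and Gbd: "\<And>h z. G h z \<Longrightarrow> cmod z \<le> C * nrm V h"
  shows "\<exists>v\<in>closure_in V {h. \<exists>z. G h z}. nrm V v \<le> C \<and> (\<forall>h z. G h z \<longrightarrow> ip V h v = z)"
proof -
  \<comment> \<open>If \<open>v\<close> represents the functional, \<open>J (h, z)\<close> equals
    \<open>(nrm V (h - v))^2 - (nrm V v)^2\<close>, so minimising over the graph approaches the
    representing vector.\<close>
  define J where "J = (\<lambda>(h, z). (nrm V h)\<^sup>2 - 2 * Re z)"
  define P where "P = {(h, z). G h z}"
  define m where "m = Inf (J ` P)"
  have bdd: "bdd_below (J ` P)"
  proof (rule bdd_belowI2[where m = "- C\<^sup>2"])
    fix p assume "p \<in> P"
    then obtain h z where p: "p = (h, z)" "G h z"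
      by (auto simp: P_def)
    have "Re z \<le> C * nrm V h"
      using Gbd[OF p(2)] complex_Re_le_cmod order_trans by blast
    moreover have "0 \<le> (nrm V h - C)\<^sup>2"
      by simp
    ultimately show "- C\<^sup>2 \<le> J p"
      by (simp add: J_def p power2_diff algebra_simps)
  qed
  have m_le: "m \<le> J (h, z)" if "G h z" for h z
    unfolding m_def using that bdd by (intro cInf_lower) (auto simp: P_def)
  have "\<exists>p\<in>P. J p < m + 1 / (real n + 1)" for n
  proof -
    have "J ` P \<noteq> {}"
      using G0 by (auto simp: P_def)
    then have "\<exists>x\<in>J ` P. x < m + 1 / (real n + 1)"
      unfolding m_def using bdd by (subst cInf_less_iff[symmetric]) auto
    then show ?thesis
      by auto
  qed
  then obtain p where p: "\<And>n. p n \<in> P" "\<And>n. J (p n) < m + 1 / (real n + 1)"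
    by metis
  define s z where "s n = fst (p n)" and "z n = snd (p n)" for n
  have G: "G (s n) (z n)" for n
    using p(1)[of n] by (auto simp: P_def s_def z_def)
  have Jlt: "(nrm V (s n))\<^sup>2 - 2 * Re (z n) < m + 1 / (real n + 1)" for n
    using p(2)[of n] by (simp add: J_def s_def z_def case_prod_unfold)
  have sV: "s n \<in> elts V" for n
    using G Gin by blast
  have cauchy: "(nrm V (s n - s k))\<^sup>2 \<le> 2 * (1 / (real n + 1) + 1 / (real k + 1))" for n k
  proof -
    \<comment> \<open>Parallelogram law: the value of \<open>J\<close> at the midpoint of two near
      minimisers is still at least \<open>m\<close>, so their distance is small.\<close>
    have "m \<le> J ((1/2) *\<^sub>C (s n + s k), (1/2) * (z n + z k))"
      using G Gadd Gscale by (intro m_le) blast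
    also have "\<dots> = (nrm V (s n + s k))\<^sup>2 / 4 - Re (z n) - Re (z k)"
      using sV by (simp add: J_def nrm_scale power_mult_distrib power2_eq_square add_divide_distrib)
    finally have "4 * m \<le> (nrm V (s n + s k))\<^sup>2 - 4 * Re (z n) - 4 * Re (z k)"
      by simp
    moreover have "(nrm V (s n + s k))\<^sup>2 + (nrm V (s n - s k))\<^sup>2 = 2 * (nrm V (s n))\<^sup>2 + 2 * (nrm V (s k))\<^sup>2"
      using sV by (simp add: nrm_add_sq nrm_diff_sq)
    ultimately show ?thesis
      using Jlt[of n] Jlt[of k] unfolding distrib_left by linarith
  qed
  have "\<exists>N. \<forall>n\<ge>N. \<forall>k\<ge>N. nrm V (s n - s k) < e" if "e > 0" for e
  proof -
    have "0 < e\<^sup>2 / 4"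
      using that by simp
    then obtain N where "inverse (real (Suc N)) < e\<^sup>2 / 4"
      using reals_Archimedean by blast
    then have N: "1 / (real N + 1) < e\<^sup>2 / 4"
      by (simp add: inverse_eq_divide add.commute)
    have "nrm V (s n - s k) < e" if "n \<ge> N" "k \<ge> N" for n k
    proof -
      have "1 / (real n + 1) \<le> 1 / (real N + 1)" "1 / (real k + 1) \<le> 1 / (real N + 1)"
        using that by (auto simp: frac_le)
      then have "(nrm V (s n - s k))\<^sup>2 < e\<^sup>2"
        using cauchy[of n k] N unfolding distrib_left by linarith
      then show ?thesis
        using \<open>e > 0\<close> by (simp add: power2_less_imp_less)
    qed
    then show ?thesis
      by blast
  qed
  then obtain v where v: "v \<in> elts V" "tends V s v"
    using hilbert sV unfolding is_hilbert_space_def by (metis image_subset_iff)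
  have rep: "ip V h v = y" if h: "G h y" for h y
  proof (rule ccontr)
    assume ne: "ip V h v \<noteq> y"
    have hV: "h \<in> elts V"
      using h Gin by blast
    define w where "w = ip V h v - y"
    \<comment> \<open>Perturbing \<open>s n\<close> by \<open>c *\<^sub>C h\<close> cannot go below
      the infimum; the limit in \<open>n\<close> leaves a variational inequality for every scalar
      \<open>c\<close>.\<close>
    have ineq: "0 \<le> 2 * Re (c * w) + (cmod c)\<^sup>2 * (nrm V h)\<^sup>2" for c
    proof (rule LIMSEQ_le_const)
      have "(\<lambda>n. ip V (s n) h) \<longlonglongrightarrow> ip V v h"
        using sV v hV by (intro tends_ip) auto
      then have "(\<lambda>n. cnj (ip V (s n) h)) \<longlonglongrightarrow> cnj (ip V v h)"
        by (intro tendsto_intros)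
      then have lim: "(\<lambda>n. ip V h (s n)) \<longlonglongrightarrow> ip V h v"
        using ip_sym[OF sV hV] ip_sym[OF v(1) hV] by simp
      have "(\<lambda>n. inverse (real (Suc n))) \<longlonglongrightarrow> 0"
        by (rule LIMSEQ_inverse_real_of_nat)
      then have "(\<lambda>n. 1 / (real n + 1)) \<longlonglongrightarrow> 0"
        by (simp add: inverse_eq_divide add.commute)
      then have "(\<lambda>n. 2 * Re (c * (ip V h (s n) - y)) + (cmod c)\<^sup>2 * (nrm V h)\<^sup>2 + 1 / (real n + 1))
        \<longlonglongrightarrow> 2 * Re (c * (ip V h v - y)) + (cmod c)\<^sup>2 * (nrm V h)\<^sup>2 + 0"
        using lim by (intro tendsto_intros)
      then show "(\<lambda>n. 2 * Re (c * (ip V h (s n) - y)) + (cmod c)\<^sup>2 * (nrm V h)\<^sup>2 + 1 / (real n + 1))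
        \<longlonglongrightarrow> 2 * Re (c * w) + (cmod c)\<^sup>2 * (nrm V h)\<^sup>2"
        by (simp add: w_def)
      show "\<exists>N. \<forall>n\<ge>N. 0 \<le> 2 * Re (c * (ip V h (s n) - y)) + (cmod c)\<^sup>2 * (nrm V h)\<^sup>2 + 1 / (real n + 1)"
      proof (intro exI allI impI)
        fix n
        have "m \<le> J (s n + c *\<^sub>C h, z n + c * y)"
          using G h Gadd Gscale by (intro m_le) blast
        also have "\<dots> = (nrm V (s n))\<^sup>2 + (cmod c)\<^sup>2 * (nrm V h)\<^sup>2 + 2 * Re (ip V (s n) (c *\<^sub>C h))
            - 2 * Re (z n) - 2 * Re (c * y)"
          using sV hV by (simp add: J_def nrm_add_sq nrm_scale power_mult_distrib)
        also have "Re (ip V (s n) (c *\<^sub>C h)) = Re (c * ip V h (s n))"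
          using ip_sym[of "c *\<^sub>C h" "s n"] sV hV by (simp add: ip_scale_left)
        finally show "0 \<le> 2 * Re (c * (ip V h (s n) - y)) + (cmod c)\<^sup>2 * (nrm V h)\<^sup>2 + 1 / (real n + 1)"
          using Jlt[of n] by (simp add: algebra_simps)
      qed
    qed
    \<comment> \<open>Since \<open>t\<close> times the squared norm of \<open>h\<close> stays below
      1, the linear term of the variational inequality outweighs the quadratic one at
      \<open>c = - t * cnj w\<close>.\<close>
    define t where "t = 1 / ((nrm V h)\<^sup>2 + 1)"
    have t: "t > 0" "t * (nrm V h)\<^sup>2 < 1"
      using zero_le_power2[of "nrm V h"] by (simp_all add: t_def divide_less_eq add_nonneg_pos)
    have w: "(cmod w)\<^sup>2 > 0"
      using ne by (simp add: w_def)
    have "0 \<le> 2 * Re (- of_real t * cnj w * w) + (cmod (- of_real t * cnj w))\<^sup>2 * (nrm V h)\<^sup>2"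
      by (rule ineq)
    also have "- of_real t * cnj w * w = of_real (- t * (cmod w)\<^sup>2)"
      using complex_norm_square[of w] by (simp add: mult.assoc mult.commute)
    also have "Re (of_real (- t * (cmod w)\<^sup>2)) = - t * (cmod w)\<^sup>2"
      by (rule Re_complex_of_real)
    also have "(cmod (- of_real t * cnj w))\<^sup>2 = t\<^sup>2 * (cmod w)\<^sup>2"
      by (simp add: norm_mult power_mult_distrib)
    finally have "t * (cmod w)\<^sup>2 * (2 - t * (nrm V h)\<^sup>2) \<le> 0"
      by (simp add: algebra_simps power2_eq_square)
    then show False
      using t w by (simp add: mult_le_0_iff)
  qed
  have "nrm V v \<le> C"
  proof -
    \<comment> \<open>The bound is tested along \<open>s n\<close>, where
      \<open>ip V (s n) v\<close> is already known to be \<open>z n\<close>.\<close>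
    have "(nrm V v)\<^sup>2 \<le> C * (0 + nrm V v)"
    proof (rule LIMSEQ_le)
      have "(\<lambda>n. ip V (s n) v) \<longlonglongrightarrow> ip V v v"
        using sV v by (intro tends_ip) auto
      then have "(\<lambda>n. Re (ip V (s n) v)) \<longlonglongrightarrow> Re (ip V v v)"
        by (rule tendsto_Re)
      then show "(\<lambda>n. Re (ip V (s n) v)) \<longlonglongrightarrow> (nrm V v)\<^sup>2"
        using v by (simp add: nrm_sq)
      show "(\<lambda>n. C * (nrm V (s n - v) + nrm V v)) \<longlonglongrightarrow> C * (0 + nrm V v)"
        using v(2) unfolding tends_def by (intro tendsto_intros)
      have "Re (ip V (s n) v) \<le> C * (nrm V (s n - v) + nrm V v)" for n
      proof -
        have "Re (ip V (s n) v) \<le> C * nrm V (s n)"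
          using Gbd[OF G[of n]] rep[OF G[of n]] complex_Re_le_cmod[of "z n"] by simp
        also have "\<dots> \<le> C * (nrm V (s n - v) + nrm V v)"
          using nrm_triangle[of "s n - v" v] sV v C by (intro mult_left_mono) auto
        finally show ?thesis .
      qed
      then show "\<exists>N. \<forall>n\<ge>N. Re (ip V (s n) v) \<le> C * (nrm V (s n - v) + nrm V v)"
        by blast
    qed
    then show ?thesis
      using C v nrm_nonneg[OF v(1)]
      by (cases "nrm V v = 0") (auto simp: power2_eq_square dest: mult_right_le_imp_le)
  qed
  moreover have "v \<in> closure_in V {h. \<exists>z. G h z}"
    using v G by (auto simp: closure_in_def)
  ultimately show ?thesis
    using rep by blast
qed

end

section \<open>Consequences of the Riesz theorem: projections and adjoints\<close>

context hilbert
begin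

lemma Riesz_subspace:
  assumes C: "C \<ge> 0" and M: "csubspace M" "M \<subseteq> elts V"
    and add: "\<And>h h'. h \<in> M \<Longrightarrow> h' \<in> M \<Longrightarrow> f (h + h') = f h + f h'"
    and scale: "\<And>h a. h \<in> M \<Longrightarrow> f (a *\<^sub>C h) = a * f h"
    and bd: "\<And>h. h \<in> M \<Longrightarrow> cmod (f h) \<le> C * nrm V h"
  shows "\<exists>v\<in>closure_in V M. nrm V v \<le> C \<and> (\<forall>h\<in>M. ip V h v = f h)"
proof -
  have 0: "0 \<in> M"
    using M by (simp add: complex_vector.subspace_0)
  have f0: "f 0 = 0"
    using scale[OF 0, of 0] by simp
  have "\<exists>v\<in>closure_in V {h. \<exists>z. h \<in> M \<and> z = f h}.
    nrm V v \<le> C \<and> (\<forall>h z. h \<in> M \<and> z = f h \<longrightarrow> ip V h v = z)"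
    using M C 0 f0 add scale bd
    by (intro Riesz_graph) (auto intro: complex_vector.subspace_add complex_vector.subspace_scale)
  then show ?thesis
    by (simp add: Ball_def)
qed

text \<open>For reproducing kernels \<open>k\<close> this is a membership test: values prescribed
  against the kernel functions come from a vector of norm at most \<open>C\<close> once the finite
  sums obey the bound. The bound also makes the prescription consistent when the \<open>k i\<close>
  are linearly dependent.\<close>

lemma Riesz_family:
  fixes k :: "'i \<Rightarrow> 'a"
  assumes C: "C \<ge> 0" and k: "\<And>i. k i \<in> elts V"
    and bd: "\<And>I c. finite I \<Longrightarrow> cmod (\<Sum>i\<in>I. c i * g i) \<le> C * nrm V (\<Sum>i\<in>I. c i *\<^sub>C k i)"
  shows "\<exists>v\<in>elts V. nrm V v \<le> C \<and> (\<forall>i. ip V (k i) v = g i)"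
proof -
  define G where "G h z \<longleftrightarrow> (\<exists>I c. finite I \<and> h = (\<Sum>i\<in>I. c i *\<^sub>C k i) \<and> z = (\<Sum>i\<in>I. c i * g i))" for h z
  have "\<exists>v\<in>closure_in V {h. \<exists>z. G h z}. nrm V v \<le> C \<and> (\<forall>h z. G h z \<longrightarrow> ip V h v = z)"
  proof (rule Riesz_graph[OF C])
    show "G 0 0"
      unfolding G_def by (intro exI[of _ "{}"]) simp
  next
    fix h z h' z' assume "G h z" "G h' z'"
    then obtain I c J d where I: "finite I" "h = (\<Sum>i\<in>I. c i *\<^sub>C k i)" "z = (\<Sum>i\<in>I. c i * g i)"
      and J: "finite J" "h' = (\<Sum>i\<in>J. d i *\<^sub>C k i)" "z' = (\<Sum>i\<in>J. d i * g i)"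
      by (auto simp: G_def)
    \<comment> \<open>Zero padding puts both combinations on the common index set
      \<open>I \<union> J\<close>.\<close>
    define c' d' where "c' i = (if i \<in> I then c i else 0)" and "d' i = (if i \<in> J then d i else 0)" for i
    have "h = (\<Sum>i\<in>I \<union> J. c' i *\<^sub>C k i)" "z = (\<Sum>i\<in>I \<union> J. c' i * g i)"
      unfolding I using I(1) J(1) by (auto simp: c'_def intro!: sum.mono_neutral_cong_left)
    moreover have "h' = (\<Sum>i\<in>I \<union> J. d' i *\<^sub>C k i)" "z' = (\<Sum>i\<in>I \<union> J. d' i * g i)"
      unfolding J using I(1) J(1) by (auto simp: d'_def intro!: sum.mono_neutral_cong_left)
    ultimately show "G (h + h') (z + z')"
      unfolding G_def using I(1) J(1)
      by (intro exI[of _ "I \<union> J"] exI[of _ "\<lambda>i. c' i + d' i"])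
        (simp add: sum.distrib complex_vector.scale_left_distrib distrib_right)
  next
    fix h z a assume "G h z"
    then obtain I c where I: "finite I" "h = (\<Sum>i\<in>I. c i *\<^sub>C k i)" "z = (\<Sum>i\<in>I. c i * g i)"
      by (auto simp: G_def)
    then show "G (a *\<^sub>C h) (a * z)"
      unfolding G_def
      by (intro exI[of _ I] exI[of _ "\<lambda>i. a * c i"])
        (simp add: complex_vector.scale_sum_right sum_distrib_left mult.assoc)
  next
    show "h \<in> elts V" if "G h z" for h z
      using that k by (auto simp: G_def intro!: sum_in)
    show "cmod z \<le> C * nrm V h" if "G h z" for h z
      using that bd by (auto simp: G_def)
  qed
  then obtain v where v: "v \<in> elts V" "nrm V v \<le> C" and rep: "\<And>h z. G h z \<Longrightarrow> ip V h v = z"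
    by (auto simp: closure_in_def)
  have "G (k i) (g i)" for i
    unfolding G_def by (intro exI[of _ "{i}"] exI[of _ "\<lambda>_. 1"]) simp
  then show ?thesis
    using v rep by blast
qed

text \<open>The projection represents the functional \<open>h \<mapsto> ip V h x\<close> on
  \<open>M\<close>. As \<open>M\<close> need not be closed, it lies in the closure.\<close>

lemma ex_projection:
  assumes M: "csubspace M" "M \<subseteq> elts V" and x: "x \<in> elts V"
  shows "\<exists>v\<in>closure_in V M. \<forall>h\<in>M. ip V h (x - v) = 0"
proof -
  have "\<exists>v\<in>closure_in V M. nrm V v \<le> nrm V x \<and> (\<forall>h\<in>M. ip V h v = ip V h x)"
  proof (rule Riesz_subspace)
    show "cmod (ip V h x) \<le> nrm V x * nrm V h" if "h \<in> M" for h
      using Cauchy_Schwarz[of h x] that M x by (auto simp: mult.commute)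
  qed (use M x in \<open>auto simp: ip_add_left ip_scale_left subset_iff\<close>)
  then obtain v where v: "v \<in> closure_in V M" "\<And>h. h \<in> M \<Longrightarrow> ip V h v = ip V h x"
    by blast
  then have "ip V h (x - v) = 0" if "h \<in> M" for h
    using that M x closure_in_elts by (simp add: ip_diff_right subset_iff)
  then show ?thesis
    using v by blast
qed

text \<open>Subtract the projection \<open>v\<close>: the difference \<open>x - v\<close> is
  orthogonal to \<open>M\<close>, hence to \<open>v\<close> and, by \<open>orth\<close>, to
  \<open>x\<close>, so it is zero. The closures of the ranges of defect operators are identified
  through this criterion.\<close>

lemma mem_closure_inI:
  assumes M: "csubspace M" "M \<subseteq> elts V" and x: "x \<in> elts V"
    and orth: "\<And>y. y \<in> elts V \<Longrightarrow> (\<And>h. h \<in> M \<Longrightarrow> ip V h y = 0) \<Longrightarrow> ip V x y = 0"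
  shows "x \<in> closure_in V M"
proof -
  obtain v where v: "v \<in> closure_in V M" "\<And>h. h \<in> M \<Longrightarrow> ip V h (x - v) = 0"
    using ex_projection[OF M x] by blast
  have vV: "v \<in> elts V"
    using v closure_in_elts by blast
  have "ip V v (x - v) = 0"
    by (rule ip_closure_eq_0[OF M(2) v(1) diff_in[OF x vV] v(2)])
  moreover have "ip V x (x - v) = 0"
    by (rule orth[OF diff_in[OF x vV] v(2)])
  ultimately have "ip V (x - v) (x - v) = 0"
    using vV x by (simp add: ip_diff_left)
  then have "x - v = 0"
    using vV x by (simp only: ip_self_eq_0 diff_in)
  then show ?thesis
    using v by simp
qed

lemma adj_props:
  assumes W: "ips W" and A: "bounded_op V W A" and y: "y \<in> elts W"
  shows "adj V W A y \<in> elts V" "u \<in> elts V \<Longrightarrow> ip V u (adj V W A y) = ip W (A u) y"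
proof -
  interpret W: ips W by fact
  obtain B where B: "\<And>x. x \<in> elts V \<Longrightarrow> nrm W (A x) \<le> B * nrm V x"
    using A unfolding bounded_op_def by blast
  have A_in: "A x \<in> elts W" if "x \<in> elts V" for x
    using A that by (auto simp: bounded_op_def)
  have A_lin: "A (x + x') = A x + A x'" "A (a *\<^sub>C x) = a *\<^sub>C A x" if "x \<in> elts V" "x' \<in> elts V" for x x' a
    using A that by (auto simp: bounded_op_def)
  \<comment> \<open>A bound \<open>B\<close> may be negative when the carrier is trivial, while the
    Riesz theorem asks for a nonnegative constant; hence the absolute value.\<close>
  have "\<exists>v\<in>closure_in V (elts V). nrm V v \<le> \<bar>B\<bar> * nrm W y \<and> (\<forall>u\<in>elts V. ip V u v = ip W (A u) y)"
  proof (rule Riesz_subspace)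
    fix h assume h: "h \<in> elts V"
    have "cmod (ip W (A h) y) \<le> nrm W (A h) * nrm W y"
      using h A_in y by (intro W.Cauchy_Schwarz) auto
    also have "\<dots> \<le> (\<bar>B\<bar> * nrm V h) * nrm W y"
      using B[OF h] h y mult_right_mono[of B "\<bar>B\<bar>" "nrm V h"]
      by (intro mult_right_mono) (simp_all, linarith)
    finally show "cmod (ip W (A h) y) \<le> \<bar>B\<bar> * nrm W y * nrm V h"
      by (simp add: algebra_simps)
  qed (use y A_in A_lin subspace_elts in \<open>auto simp: W.ip_add_left W.ip_scale_left\<close>)
  then have "\<exists>v. v \<in> elts V \<and> (\<forall>u\<in>elts V. ip W (A u) y = ip V u v)"
    using closure_in_elts by (metis subsetD)
  from someI_ex[OF this]
  show "adj V W A y \<in> elts V" "u \<in> elts V \<Longrightarrow> ip V u (adj V W A y) = ip W (A u) y"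
    by (auto simp: adj_def)
qed

end

section \<open>Orthonormal eigenbases\<close>

text \<open>A repeated vector gives a relation with coefficients 1 and -1, which is why injectivity
  follows too. The maximality condition counts indices, so repetitions have to show up as
  dependence.\<close>

lemma family_independent:
  fixes f :: "'i \<Rightarrow> 'v::complex_vector"
  assumes I: "finite I" and ind: "\<And>c. (\<Sum>i\<in>I. c i *\<^sub>C f i) = 0 \<Longrightarrow> \<forall>i\<in>I. c i = 0"
  shows "inj_on f I" "\<not> cdependent (f ` I)"
proof -
  show inj: "inj_on f I"
  proof (rule inj_onI, rule ccontr)
    fix i j assume ij: "i \<in> I" "j \<in> I" "f i = f j" "i \<noteq> j"
    define c where "c k = (if k = i then 1 else if k = j then -1 else 0 :: complex)" for k
    have "(\<Sum>k\<in>I. c k *\<^sub>C f k) = (\<Sum>k\<in>{i, j}. c k *\<^sub>C f k)"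
      using ij I by (intro sum.mono_neutral_right) (auto simp: c_def)
    also have "\<dots> = 0"
      using ij by (simp add: c_def)
    finally have "\<forall>k\<in>I. c k = 0"
      by (rule ind)
    then show False
      using ij by (auto simp: c_def)
  qed
  show "\<not> cdependent (f ` I)"
  proof (rule complex_vector.independent_if_scalars_zero)
    fix c x assume c: "(\<Sum>x\<in>f ` I. c x *\<^sub>C x) = 0" and x: "x \<in> f ` I"
    have "(\<Sum>i\<in>I. c (f i) *\<^sub>C f i) = 0"
      using c by (simp add: sum.reindex[OF inj])
    then show "c x = 0"
      using ind[of "\<lambda>i. c (f i)"] x by auto
  qed (use I in simp)
qed

lemma edim_cspan_finite: "finite B \<Longrightarrow> edim (cspan B) = enat (cdim B)"
  unfolding edim_def by (auto simp: complex_vector.dim_span)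

text \<open>Converts the dimension equalities in the definition of maximality into linear
  independence of an indexed family.\<close>

lemma edim_cspan_family:
  fixes f :: "'i \<Rightarrow> 'v::complex_vector"
  assumes I: "finite I"
  shows "edim (cspan (f ` I)) = enat (card I) \<longleftrightarrow> (\<forall>c. (\<Sum>i\<in>I. c i *\<^sub>C f i) = 0 \<longrightarrow> (\<forall>i\<in>I. c i = 0))"
proof
  assume "\<forall>c. (\<Sum>i\<in>I. c i *\<^sub>C f i) = 0 \<longrightarrow> (\<forall>i\<in>I. c i = 0)"
  then have "inj_on f I" "\<not> cdependent (f ` I)"
    using family_independent[OF I] by blast+
  then show "edim (cspan (f ` I)) = enat (card I)"
    using I by (simp add: edim_cspan_finite complex_vector.dim_eq_card_independent card_image)
next
  assume "edim (cspan (f ` I)) = enat (card I)"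
  then have dim: "cdim (f ` I) = card I"
    using I by (simp add: edim_cspan_finite)
  show "\<forall>c. (\<Sum>i\<in>I. c i *\<^sub>C f i) = 0 \<longrightarrow> (\<forall>i\<in>I. c i = 0)"
  proof (intro allI impI ballI, rule ccontr)
    fix c j assume c: "(\<Sum>i\<in>I. c i *\<^sub>C f i) = 0" and j: "j \<in> I" "c j \<noteq> 0"
    let ?J = "I - {j}"
    have "c j *\<^sub>C f j = - (\<Sum>i\<in>?J. c i *\<^sub>C f i)"
      using c j I by (simp add: sum.remove eq_neg_iff_add_eq_0)
    then have "(1 / c j) *\<^sub>C (c j *\<^sub>C f j) = (1 / c j) *\<^sub>C - (\<Sum>i\<in>?J. c i *\<^sub>C f i)"
      by (rule arg_cong)
    then have "f j = (1 / c j) *\<^sub>C - (\<Sum>i\<in>?J. c i *\<^sub>C f i)"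
      using j by simp
    also have "\<dots> \<in> cspan (f ` ?J)"
      by (intro complex_vector.span_scale complex_vector.span_neg complex_vector.span_sum
          complex_vector.span_base) auto
    finally have fj: "f j \<in> cspan (f ` ?J)" .
    have "f i \<in> cspan (f ` ?J)" if "i \<in> I" for i
      using fj that by (cases "i = j") (auto intro: complex_vector.span_base)
    then have "f ` I \<subseteq> cspan (f ` ?J)"
      by blast
    then have "cdim (f ` I) \<le> card (f ` ?J)"
      using I by (intro complex_vector.dim_le_card) auto
    also have "\<dots> \<le> card ?J"
      using I by (intro card_image_le) auto
    also have "\<dots> < card I"
      using I j by (intro card_Diff1_less)
    finally show False
      using dim by simp
  qed
qed

text \<open>Write \<open>ev p\<close> for \<open>p(A) v\<close>. Among the nonzero \<open>p\<close>
  with \<open>ev p = 0\<close> take one of least degree and split off a root \<open>r\<close>: the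
  cofactor \<open>q\<close> does not annihilate \<open>v\<close>, so \<open>ev q\<close> is an
  eigenvector for \<open>r\<close>.\<close>

lemma ex_eigenvector:
  fixes A :: "'v::complex_vector \<Rightarrow> 'v"
  assumes W: "csubspace W" "finite B" "W \<subseteq> cspan B" "W \<noteq> {0}"
    and A_in: "\<And>x. x \<in> W \<Longrightarrow> A x \<in> W"
    and A_add: "\<And>x y. x \<in> W \<Longrightarrow> y \<in> W \<Longrightarrow> A (x + y) = A x + A y"
    and A_scale: "\<And>x a. x \<in> W \<Longrightarrow> A (a *\<^sub>C x) = a *\<^sub>C A x"
  shows "\<exists>x\<in>W. x \<noteq> 0 \<and> (\<exists>r. A x = r *\<^sub>C x)"
proof -
  obtain v where v: "v \<in> W" "v \<noteq> 0"
    using W complex_vector.subspace_0 by blast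
  have pow: "(A ^^ i) v \<in> W" for i
    by (induction i) (auto simp: v A_in)
  have A_0: "A 0 = 0"
    using A_scale[of v 0] v by simp
  have A_sum: "A (\<Sum>i\<in>I. c i *\<^sub>C (A ^^ i) v) = (\<Sum>i\<in>I. c i *\<^sub>C (A ^^ Suc i) v)" for I and c :: "nat \<Rightarrow> complex"
    by (induction I rule: infinite_finite_induct)
      (auto simp: A_0 A_add A_scale pow W complex_vector.subspace_scale complex_vector.subspace_sum)
  define ev where "ev p = (\<Sum>i\<le>degree p. coeff p i *\<^sub>C (A ^^ i) v)" for p :: "complex poly"
  have ev_W: "ev p \<in> W" for p
    unfolding ev_def using W pow
    by (intro complex_vector.subspace_sum complex_vector.subspace_scale) auto
  have ev_le: "ev p = (\<Sum>i\<le>n. coeff p i *\<^sub>C (A ^^ i) v)" if "degree p \<le> n" for p n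
    unfolding ev_def using that by (intro sum.mono_neutral_left) (auto simp: coeff_eq_0)
  have ev_root: "ev ([:-r, 1:] * q) = A (ev q) - r *\<^sub>C ev q" for r q
  proof -
    define n where "n = degree q"
    have "degree ([:-r, 1:] * q) \<le> Suc n"
      unfolding n_def by (rule order_trans[OF degree_mult_le]) simp
    then have "ev ([:-r, 1:] * q) = (\<Sum>i\<le>Suc n. coeff ([:-r, 1:] * q) i *\<^sub>C (A ^^ i) v)"
      by (rule ev_le)
    also have "\<dots> = (\<Sum>i\<le>Suc n. coeff (pCons 0 q) i *\<^sub>C (A ^^ i) v - r *\<^sub>C (coeff q i *\<^sub>C (A ^^ i) v))"
      by (intro sum.cong) (simp_all add: complex_vector.scale_left_diff_distrib)
    also have "\<dots> = (\<Sum>i\<le>Suc n. coeff (pCons 0 q) i *\<^sub>C (A ^^ i) v) - r *\<^sub>C ev q"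
      using ev_le[of q "Suc n"] by (simp only: sum_subtractf complex_vector.scale_sum_right n_def le_SucI order_refl)
    also have "(\<Sum>i\<le>Suc n. coeff (pCons 0 q) i *\<^sub>C (A ^^ i) v) = A (ev q)"
      unfolding ev_def n_def A_sum by (subst sum.atMost_Suc_shift) simp
    finally show ?thesis .
  qed
  define P where "P p \<longleftrightarrow> p \<noteq> 0 \<and> ev p = 0" for p
  have "\<exists>p. P p"
  proof -
    \<comment> \<open>The \<open>n + 1\<close> vectors \<open>v\<close>, \<open>A v\<close>, ...,
      \<open>A^n v\<close> lie in the span of \<open>n\<close> vectors, so some nonzero polynomial
      annihilates \<open>v\<close>.\<close>
    define n where "n = card B"
    have "\<exists>c. (\<Sum>i\<le>n. c i *\<^sub>C (A ^^ i) v) = 0 \<and> (\<exists>i\<le>n. c i \<noteq> 0)"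
    proof (rule ccontr)
      assume "\<nexists>c. (\<Sum>i\<le>n. c i *\<^sub>C (A ^^ i) v) = 0 \<and> (\<exists>i\<le>n. c i \<noteq> 0)"
      then have "inj_on (\<lambda>i. (A ^^ i) v) {..n}" "\<not> cdependent ((\<lambda>i. (A ^^ i) v) ` {..n})"
        using family_independent[of "{..n}" "\<lambda>i. (A ^^ i) v"] by auto
      moreover have "(\<lambda>i. (A ^^ i) v) ` {..n} \<subseteq> cspan B"
        using pow W by auto
      ultimately have "card {..n} \<le> card B"
        using complex_vector.independent_span_bound[of B "(\<lambda>i. (A ^^ i) v) ` {..n}"] W
        by (simp add: card_image)
      then show False
        by (simp add: n_def)
    qed
    then obtain c i where c: "(\<Sum>i\<le>n. c i *\<^sub>C (A ^^ i) v) = 0" "i \<le> n" "c i \<noteq> 0"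
      by blast
    define p where "p = (\<Sum>i\<le>n. monom (c i) i)"
    have cp: "coeff p i = (if i \<le> n then c i else 0)" for i
      by (simp add: p_def coeff_sum)
    have "degree p \<le> n"
      by (rule degree_le) (simp add: cp)
    then have "ev p = (\<Sum>i\<le>n. coeff p i *\<^sub>C (A ^^ i) v)"
      by (rule ev_le)
    then have "ev p = 0"
      using c by (simp add: cp)
    moreover have "p \<noteq> 0"
      using c cp[of i] by auto
    ultimately show ?thesis
      unfolding P_def by blast
  qed
  then obtain p where p: "P p" and min: "\<And>q. P q \<Longrightarrow> degree p \<le> degree q"
    using exists_least_iff[of "\<lambda>n. \<exists>p. P p \<and> degree p = n"] by (metis not_le_imp_less)
  have "degree p > 0"
  proof (rule ccontr)
    assume "\<not> degree p > 0"
    then obtain a where a: "p = [:a:]"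
      by (meson degree_eq_zeroE gr0I)
    then have "ev p = a *\<^sub>C v"
      by (simp add: ev_def)
    then show False
      using p v a by (simp add: P_def)
  qed
  then obtain r where "poly p r = 0"
    using fundamental_theorem_of_algebra[of p] by (metis constant_degree less_irrefl)
  then obtain q where q: "p = [:-r, 1:] * q"
    by (metis poly_eq_0_iff_dvd dvdE)
  have "q \<noteq> 0"
    using p q by (auto simp: P_def)
  then have "degree q < degree p"
    unfolding q by (subst degree_mult_eq) auto
  then have "ev q \<noteq> 0"
    using min[of q] \<open>q \<noteq> 0\<close> by (auto simp: P_def)
  moreover have "A (ev q) = r *\<^sub>C ev q"
    using ev_root[of r q] p q by (simp add: P_def)
  ultimately show ?thesis
    using ev_W by blast
qed

context ips
begin

definition orthonormal :: "'v set \<Rightarrow> bool" where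
  "orthonormal E \<longleftrightarrow> finite E \<and> E \<subseteq> elts V \<and> (\<forall>x\<in>E. \<forall>y\<in>E. ip V x y = (if x = y then 1 else 0))"

lemma ip_orthonormal_sum:
  assumes E: "orthonormal E" and e: "e \<in> E"
  shows "ip V (\<Sum>x\<in>E. c x *\<^sub>C x) e = c e"
proof -
  have "ip V (\<Sum>x\<in>E. c x *\<^sub>C x) e = (\<Sum>x\<in>E. c x * ip V x e)"
    using assms by (subst ip_sum_left) (auto simp: orthonormal_def ip_scale_left subset_iff intro!: sum.cong)
  also have "\<dots> = (\<Sum>x\<in>E. if x = e then c x else 0)"
    using assms by (intro sum.cong) (auto simp: orthonormal_def)
  finally show ?thesis
    using assms by (simp add: orthonormal_def)
qed

lemma orthonormal_independent:
  assumes "orthonormal E"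
  shows "\<not> cdependent E"
proof (rule complex_vector.independent_if_scalars_zero)
  fix c x assume "(\<Sum>x\<in>E. c x *\<^sub>C x) = 0" "x \<in> E"
  then show "c x = 0"
    using ip_orthonormal_sum[OF assms, of x c] assms by (auto simp: orthonormal_def subset_iff)
qed (use assms in \<open>simp add: orthonormal_def\<close>)

lemma cspan_subset_elts: "E \<subseteq> elts V \<Longrightarrow> cspan E \<subseteq> elts V"
  by (rule complex_vector.span_minimal[OF _ subspace_elts])

lemma orthonormal_expansion:
  assumes E: "orthonormal E" and x: "x \<in> cspan E"
  shows "x = (\<Sum>e\<in>E. ip V x e *\<^sub>C e)"
proof -
  have "finite E"
    using E by (simp add: orthonormal_def)
  then obtain c where c: "x = (\<Sum>e\<in>E. c e *\<^sub>C e)"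
    using x complex_vector.span_finite by auto
  then have "ip V x e = c e" if "e \<in> E" for e
    using ip_orthonormal_sum[OF E that] by simp
  then show ?thesis
    using c by simp
qed

text \<open>Finite dimensional subspaces are closed: for \<open>x\<close> in the closure, the error
  \<open>x - p\<close> of its expansion along \<open>E\<close> is orthogonal to the span, hence by
  continuity to \<open>x\<close> itself, so it vanishes.\<close>

lemma closure_in_cspan_orthonormal:
  assumes E: "orthonormal E"
  shows "closure_in V (cspan E) = cspan E"
proof
  have EV: "E \<subseteq> elts V" and fin: "finite E"
    using E by (auto simp: orthonormal_def)
  then show "cspan E \<subseteq> closure_in V (cspan E)"
    by (intro subset_closure_in cspan_subset_elts)
  show "closure_in V (cspan E) \<subseteq> cspan E"
  proof
    fix x assume x: "x \<in> closure_in V (cspan E)"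
    then have xV: "x \<in> elts V"
      using closure_in_elts by blast
    define p where "p = (\<Sum>e\<in>E. ip V x e *\<^sub>C e)"
    have pE: "p \<in> cspan E"
      unfolding p_def
      by (intro complex_vector.span_sum complex_vector.span_scale complex_vector.span_base)
    then have pV: "p \<in> elts V"
      using cspan_subset_elts[OF EV] by blast
    have orth: "ip V e (x - p) = 0" if "e \<in> E" for e
    proof -
      have eV: "e \<in> elts V"
        using that EV by blast
      have "ip V (x - p) e = 0"
        using that eV xV pV ip_orthonormal_sum[OF E that] by (simp add: ip_diff_left p_def)
      then show ?thesis
        using ip_sym[of "x - p" e] eV xV pV by simp
    qed
    have orth': "ip V h (x - p) = 0" if "h \<in> cspan E" for h
    proof -
      have "ip V h (x - p) = ip V (\<Sum>e\<in>E. ip V h e *\<^sub>C e) (x - p)"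
        using orthonormal_expansion[OF E that] by simp
      also have "\<dots> = (\<Sum>e\<in>E. ip V h e * ip V e (x - p))"
        using EV xV pV by (subst ip_sum_left) (auto simp: ip_scale_left subset_iff intro!: sum.cong)
      finally show ?thesis
        using orth by simp
    qed
    have "ip V x (x - p) = 0"
      by (rule ip_closure_eq_0[OF cspan_subset_elts[OF EV] x diff_in[OF xV pV] orth'])
    then have "ip V (x - p) (x - p) = 0"
      using orth'[OF pE] xV pV by (simp add: ip_diff_left)
    then have "x - p = 0"
      using xV pV by (simp only: ip_self_eq_0 diff_in)
    then show "x \<in> cspan E"
      using pE by simp
  qed
qed

text \<open>A maximal orthonormal set of eigenvectors in \<open>W\<close> has to span: by
  self-adjointness its orthogonal complement in \<open>W\<close> is invariant, and a nonzero
  complement would supply one more eigenvector. With the identity for \<open>A\<close> this is the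
  existence of orthonormal bases.\<close>

lemma orthonormal_eigenbasis:
  assumes W: "csubspace W" "W \<subseteq> elts V" and B: "finite B" "W \<subseteq> cspan B"
    and A_in: "\<And>x. x \<in> W \<Longrightarrow> A x \<in> W"
    and A_add: "\<And>x y. x \<in> W \<Longrightarrow> y \<in> W \<Longrightarrow> A (x + y) = A x + A y"
    and A_scale: "\<And>x a. x \<in> W \<Longrightarrow> A (a *\<^sub>C x) = a *\<^sub>C A x"
    and sa: "\<And>x y. x \<in> W \<Longrightarrow> y \<in> W \<Longrightarrow> ip V (A x) y = ip V x (A y)"
  obtains E where "orthonormal E" "cspan E = W" "\<And>e. e \<in> E \<Longrightarrow> \<exists>r. A e = r *\<^sub>C e"
proof -
  define P where "P E \<longleftrightarrow> orthonormal E \<and> E \<subseteq> W \<and> (\<forall>e\<in>E. \<exists>r. A e = r *\<^sub>C e)" for E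
  have "P {}"
    by (simp add: P_def orthonormal_def)
  moreover have "card E < Suc (card B)" if "P E" for E
  proof -
    have "E \<subseteq> cspan B" "\<not> cdependent E"
      using that B orthonormal_independent by (auto simp: P_def)
    then show ?thesis
      using complex_vector.independent_span_bound[OF B(1)] by (simp add: less_Suc_eq_le)
  qed
  ultimately obtain E where PE: "P E" and max: "\<And>F. P F \<Longrightarrow> card F \<le> card E"
    using ex_has_greatest_nat[of P "{}" card "Suc (card B)"] by (metis less_imp_le)
  have E: "orthonormal E" "E \<subseteq> W" "finite E" and eig: "\<And>e. e \<in> E \<Longrightarrow> \<exists>r. A e = r *\<^sub>C e"
    using PE by (auto simp: P_def orthonormal_def)
  have EV: "e \<in> elts V" if "e \<in> E" for e
    using that E W by blast
  have WV: "x \<in> elts V" if "x \<in> W" for x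
    using that W by blast
  have "W \<subseteq> cspan E"
  proof
    fix x assume x: "x \<in> W"
    define W' where "W' = {y \<in> W. \<forall>e\<in>E. ip V y e = 0}"
    define y where "y = x - (\<Sum>e\<in>E. ip V x e *\<^sub>C e)"
    have sW: "(\<Sum>e\<in>E. ip V x e *\<^sub>C e) \<in> W"
      using W E by (intro complex_vector.subspace_sum complex_vector.subspace_scale) auto
    have "y \<in> W'"
      using x sW W EV ip_orthonormal_sum[OF E(1)]
      by (auto simp: W'_def y_def WV ip_diff_left complex_vector.subspace_diff)
    have W'sub: "csubspace W'"
      using W EV
      by (intro complex_vector.subspaceI)
        (auto simp: W'_def WV ip_add_left ip_scale_left complex_vector.subspace_0
          complex_vector.subspace_add complex_vector.subspace_scale)
    have "y = 0"
    proof (rule ccontr)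
      assume "y \<noteq> 0"
      have "\<exists>x\<in>W'. x \<noteq> 0 \<and> (\<exists>r. A x = r *\<^sub>C x)"
      proof (rule ex_eigenvector[OF W'sub B(1)])
        show "W' \<subseteq> cspan B" "W' \<noteq> {0}"
          using \<open>y \<in> W'\<close> \<open>y \<noteq> 0\<close> B by (auto simp: W'_def)
        show "A z \<in> W'" if z: "z \<in> W'" for z
        proof -
          have "ip V (A z) e = 0" if e: "e \<in> E" for e
          proof -
            obtain r where r: "A e = r *\<^sub>C e"
              using eig[OF e] by blast
            have "ip V (A z) e = ip V z (A e)"
              using z e E by (intro sa) (auto simp: W'_def)
            also have "\<dots> = cnj r * ip V z e"
              using z e EV by (simp add: r ip_scale_right W'_def WV)
            finally show ?thesis
              using z e by (simp add: W'_def)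
          qed
          then show ?thesis
            using z A_in by (simp add: W'_def)
        qed
      qed (auto simp: W'_def A_add A_scale)
      then obtain z r where z: "z \<in> W'" "z \<noteq> 0" "A z = r *\<^sub>C z"
        by blast
      have zW: "z \<in> W" and zE: "\<And>e. e \<in> E \<Longrightarrow> ip V z e = 0"
        using z by (auto simp: W'_def)
      define w where "w = (1 / of_real (nrm V z)) *\<^sub>C z"
      have nz: "nrm V z > 0"
        using z nrm_eq_0[of z] nrm_nonneg[of z] WV[OF zW] by linarith
      have wW: "w \<in> W"
        using zW W by (simp add: w_def complex_vector.subspace_scale)
      have ww: "ip V w w = 1"
        using nz WV[OF zW] ip_self[of z]
        by (simp add: w_def ip_scale_left ip_scale_right power2_eq_square)
      have we: "ip V w e = 0" "ip V e w = 0" if "e \<in> E" for e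
        using zE[OF that] ip_sym[of z e] that EV WV[OF zW]
        by (auto simp: w_def ip_scale_left ip_scale_right)
      then have "w \<notin> E"
        using ww by auto
      have "A w = r *\<^sub>C w"
        using z zW by (simp add: w_def A_scale mult.commute)
      then have "P (insert w E)"
        using PE wW ww we WV[OF wW] \<open>w \<notin> E\<close> by (auto simp: P_def orthonormal_def)
      then show False
        using max[of "insert w E"] \<open>w \<notin> E\<close> E by simp
    qed
    then have "x = (\<Sum>e\<in>E. ip V x e *\<^sub>C e)"
      by (simp add: y_def)
    also have "\<dots> \<in> cspan E"
      by (intro complex_vector.span_sum complex_vector.span_scale complex_vector.span_base)
    finally show "x \<in> cspan E" .
  qed
  moreover have "cspan E \<subseteq> W"
    using E W by (intro complex_vector.span_minimal)
  ultimately show thesis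
    using that E eig by blast
qed

end

section \<open>Defect spaces of contractive tuples\<close>

context ips
begin

lemma nrm_sum: "(\<And>i. i \<in> I \<Longrightarrow> f i \<in> elts V) \<Longrightarrow> nrm V (\<Sum>i\<in>I. f i) \<le> (\<Sum>i\<in>I. nrm V (f i))"
proof (induction I rule: infinite_finite_induct)
  case (insert i I)
  then have "nrm V (f i + (\<Sum>i\<in>I. f i)) \<le> nrm V (f i) + nrm V (\<Sum>i\<in>I. f i)"
    by (intro nrm_triangle sum_in) auto
  then show ?case
    using insert by force
qed auto

text \<open>Polarization: every \<open>ip V (D u) u\<close> is real; \<open>u = x + y\<close>
  compares the imaginary parts of the mixed terms and \<open>u = x + \<i> *\<^sub>C y\<close> their
  real parts.\<close>

lemma positive_op_selfadjoint:
  assumes D: "positive_op V D" and x: "x \<in> elts V" and y: "y \<in> elts V"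
  shows "ip V (D x) y = ip V x (D y)"
proof -
  have D_in: "\<And>x. x \<in> elts V \<Longrightarrow> D x \<in> elts V"
    and D_add: "\<And>x y. x \<in> elts V \<Longrightarrow> y \<in> elts V \<Longrightarrow> D (x + y) = D x + D y"
    and D_scale: "\<And>x a. x \<in> elts V \<Longrightarrow> D (a *\<^sub>C x) = a *\<^sub>C D x"
    and pos: "\<And>x. x \<in> elts V \<Longrightarrow> ip V (D x) x \<in> \<real>\<^sub>\<ge>\<^sub>0"
    using D unfolding positive_op_def bounded_op_def by blast+
  have real: "Im (ip V (D u) u) = 0" if "u \<in> elts V" for u
    using pos[OF that] by (simp add: complex_nonneg_Reals_iff)
  have "Im (ip V (D x) y + ip V (D y) x) = 0"
    using real[of "x + y"] real[OF x] real[OF y] x y D_in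
    by (simp add: D_add ip_add_left ip_add_right)
  moreover have "Re (ip V (D x) y) = Re (ip V (D y) x)"
    using real[of "x + \<i> *\<^sub>C y"] real[OF x] real[OF y] x y D_in
    by (simp add: D_add D_scale ip_add_left ip_add_right ip_scale_left ip_scale_right)
  ultimately have "ip V (D x) y = cnj (ip V (D y) x)"
    by (simp add: complex_eq_iff)
  then show ?thesis
    using ip_sym[of "D y" x] x y D_in by simp
qed

end

context hilbert
begin

lemma ip_ext:
  assumes "x \<in> elts V" "y \<in> elts V" "\<And>w. w \<in> elts V \<Longrightarrow> ip V w x = ip V w y"
  shows "x = y"
proof -
  have "ip V (x - y) (x - y) = 0"
    using assms by (simp add: ip_diff_right)
  then show ?thesis
    using assms by (simp only: ip_self_eq_0 diff_in right_minus_eq)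
qed

text \<open>As \<open>adj\<close> picks a vector by \<open>SOME\<close>, linearity rests on
  \<open>ip_ext\<close>: a vector of the carrier is determined by its inner products.\<close>

lemma adj_linear:
  assumes W: "ips W" and A: "bounded_op V W A" and x: "x \<in> elts W"
  shows "y \<in> elts W \<Longrightarrow> adj V W A (x + y) = adj V W A x + adj V W A y"
    and "adj V W A (a *\<^sub>C x) = a *\<^sub>C adj V W A x"
proof -
  interpret W: ips W by fact
  note adj = adj_props[OF W A]
  have A_in: "\<And>x. x \<in> elts V \<Longrightarrow> A x \<in> elts W"
    using A by (simp add: bounded_op_def)
  show "adj V W A (a *\<^sub>C x) = a *\<^sub>C adj V W A x"
    using x by (intro ip_ext) (simp_all add: adj A_in ip_scale_right W.ip_scale_right)
  assume "y \<in> elts W"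
  then show "adj V W A (x + y) = adj V W A x + adj V W A y"
    using x by (intro ip_ext) (simp_all add: adj A_in ip_add_right W.ip_add_right)
qed

end

locale finite_defect = hilbert V for V :: "'v::complex_vector ip_space" +
  fixes T :: "'d::finite \<Rightarrow> 'v \<Rightarrow> 'v"
  assumes contractive: "contractive_tuple V T"
    and finite_defect: "Delta V T 1 < \<infinity>"
begin

abbreviation "D \<equiv> defect_op V T"
abbreviation "D1 \<equiv> defect_space V T 1"

lemma T_bounded: "bounded_op V V (T i)"
  using contractive by (simp add: contractive_tuple_def)

lemma T_in [simp]: "x \<in> elts V \<Longrightarrow> T i x \<in> elts V"
  and T_add: "x \<in> elts V \<Longrightarrow> y \<in> elts V \<Longrightarrow> T i (x + y) = T i x + T i y"
  and T_scale: "x \<in> elts V \<Longrightarrow> T i (a *\<^sub>C x) = a *\<^sub>C T i x"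
  using T_bounded[of i] by (auto simp: bounded_op_def)

lemma T_diff: "x \<in> elts V \<Longrightarrow> y \<in> elts V \<Longrightarrow> T i (x - y) = T i x - T i y"
  using T_add[of "x - y" y i] by simp

lemma T_0: "T i 0 = 0"
  using T_scale[of 0 i 0] by simp

abbreviation Ta :: "'d \<Rightarrow> 'v \<Rightarrow> 'v" where "Ta i \<equiv> adj V V (T i)"

lemma Ta_in [simp]: "x \<in> elts V \<Longrightarrow> Ta i x \<in> elts V"
  by (rule adj_props(1)[OF ips_axioms T_bounded])

lemma ip_Ta: "x \<in> elts V \<Longrightarrow> y \<in> elts V \<Longrightarrow> ip V x (Ta i y) = ip V (T i x) y"
  by (rule adj_props(2)[OF ips_axioms T_bounded])

section \<open>The operator \<open>I - Psi(I)\<close> and its square root\<close>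

definition A :: "'v \<Rightarrow> 'v" where "A x = x - Psi V T id x"

lemma A_eq: "A x = x - (\<Sum>i\<in>UNIV. T i (Ta i x))"
  by (simp add: A_def Psi_def)

lemma A_positive: "positive_op V A"
  using contractive by (simp add: contractive_tuple_def A_def[abs_def])

lemma A_in [simp]: "x \<in> elts V \<Longrightarrow> A x \<in> elts V"
  and A_add: "x \<in> elts V \<Longrightarrow> y \<in> elts V \<Longrightarrow> A (x + y) = A x + A y"
  and A_scale: "x \<in> elts V \<Longrightarrow> A (a *\<^sub>C x) = a *\<^sub>C A x"
  using A_positive by (auto simp: positive_op_def bounded_op_def)

lemmas A_selfadjoint = positive_op_selfadjoint[OF A_positive]

lemma range_A_subspace: "csubspace (A ` elts V)"
proof (rule complex_vector.subspaceI)
  show "0 \<in> A ` elts V"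
    using A_scale[of 0 0] by (auto intro!: image_eqI[of _ _ 0])
qed (auto simp: A_add[symmetric] A_scale[symmetric])

lemma D1_eq: "D1 = closure_in V (A ` elts V)"
  by (simp add: defect_space_def A_def[abs_def])

lemma range_A_elts: "A ` elts V \<subseteq> elts V"
  by auto

lemma D1_subspace: "csubspace D1" and D1_elts: "D1 \<subseteq> elts V" and A_D1: "x \<in> elts V \<Longrightarrow> A x \<in> D1"
  unfolding D1_eq
  using subspace_closure_in[OF range_A_subspace range_A_elts] closure_in_elts
    subset_closure_in[OF range_A_elts]
  by blast+

lemma D1_finite: "\<exists>B. finite B \<and> D1 \<subseteq> cspan B"
  using finite_defect by (auto simp: Delta_def edim_def split: if_splits)

lemma A_eigenbasis: "\<exists>E. orthonormal E \<and> cspan E = D1 \<and> (\<forall>e\<in>E. \<exists>r. A e = r *\<^sub>C e)"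
proof -
  obtain B where B: "finite B" "D1 \<subseteq> cspan B"
    using D1_finite by blast
  have V: "x \<in> elts V" if "x \<in> D1" for x
    using that D1_elts by blast
  show ?thesis
    by (rule orthonormal_eigenbasis[OF D1_subspace D1_elts B, of A])
      (auto simp: V A_D1 A_add A_scale A_selfadjoint simp del: One_nat_def)
qed

text \<open>This gives content to the \<open>SOME\<close> in \<open>defect_op\<close>. As
  \<open>A\<close> is self-adjoint with range in the finite dimensional \<open>D1\<close>, it is
  diagonal on an eigenbasis of \<open>D1\<close> and zero on the complement; the root
  \<open>R\<close> replaces each eigenvalue by its square root.\<close>

lemma ex_defect_op: "\<exists>D. positive_op V D \<and> (\<forall>x\<in>elts V. D (D x) = x - Psi V T id x)"
proof -
  obtain E where E: "orthonormal E" "cspan E = D1" and "\<forall>e\<in>E. \<exists>r. A e = r *\<^sub>C e"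
    using A_eigenbasis by blast
  then obtain r where r: "\<And>e. e \<in> E \<Longrightarrow> A e = r e *\<^sub>C e"
    by metis
  have EV: "e \<in> elts V" if "e \<in> E" for e
    using that E by (auto simp: orthonormal_def)
  have fin: "finite E"
    using E by (simp add: orthonormal_def)
  have ee: "ip V e e = 1" if "e \<in> E" for e
    using that E by (simp add: orthonormal_def)
  define s where "s e = sqrt (Re (r e))" for e
  have s: "s e \<ge> 0" "complex_of_real (s e) * complex_of_real (s e) = r e" if "e \<in> E" for e
  proof -
    have "ip V (A e) e = r e"
      using that EV by (simp add: r ip_scale_left ee)
    moreover have "ip V (A e) e \<in> \<real>\<^sub>\<ge>\<^sub>0"
      using A_positive EV that by (simp add: positive_op_def)
    ultimately have "Re (r e) \<ge> 0" "Im (r e) = 0"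
      by (auto simp: complex_nonneg_Reals_iff)
    then show "s e \<ge> 0" "complex_of_real (s e) * complex_of_real (s e) = r e"
      by (auto simp: s_def complex_eq_iff)
  qed
  define R where "R x = (\<Sum>e\<in>E. (of_real (s e) * ip V x e) *\<^sub>C e)" for x
  have R_in: "R x \<in> elts V" if "x \<in> elts V" for x
    unfolding R_def using EV by (intro sum_in scale_in)
  have bd: "nrm V (R x) \<le> (\<Sum>e\<in>E. s e) * nrm V x" if x: "x \<in> elts V" for x
  proof -
    have "nrm V (R x) \<le> (\<Sum>e\<in>E. nrm V ((of_real (s e) * ip V x e) *\<^sub>C e))"
      unfolding R_def using EV by (intro nrm_sum scale_in)
    also have "\<dots> \<le> (\<Sum>e\<in>E. s e * nrm V x)"
    proof (rule sum_mono)
      fix e assume e: "e \<in> E"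
      have "nrm V e = 1"
        using ee[OF e] by (simp add: nrm_def)
      moreover have "cmod (ip V x e) \<le> nrm V x"
        using Cauchy_Schwarz[OF x EV[OF e]] \<open>nrm V e = 1\<close> by simp
      ultimately show "nrm V ((of_real (s e) * ip V x e) *\<^sub>C e) \<le> s e * nrm V x"
        using s[OF e] by (simp add: nrm_scale EV[OF e] norm_mult mult_left_mono)
    qed
    finally show ?thesis
      by (simp add: sum_distrib_right)
  qed
  have "bounded_op V V R"
    unfolding bounded_op_def
  proof (intro conjI ballI allI exI)
    fix x y a assume x: "x \<in> elts V"
    show "R x \<in> elts V" "nrm V (R x) \<le> (\<Sum>e\<in>E. s e) * nrm V x"
      using R_in bd x by auto
    show "R (a *\<^sub>C x) = a *\<^sub>C R x"
      unfolding R_def complex_vector.scale_sum_right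
      using x EV by (intro sum.cong) (auto simp: ip_scale_left mult_ac)
    assume "y \<in> elts V"
    then show "R (x + y) = R x + R y"
      unfolding R_def sum.distrib[symmetric]
      using x EV by (intro sum.cong) (auto simp: ip_add_left distrib_left complex_vector.scale_left_distrib)
  qed
  moreover have "ip V (R x) x \<in> \<real>\<^sub>\<ge>\<^sub>0" if x: "x \<in> elts V" for x
  proof -
    have "ip V (R x) x = (\<Sum>e\<in>E. of_real (s e) * ip V x e * ip V e x)"
      unfolding R_def using x EV
      by (subst ip_sum_left) (auto simp: ip_scale_left intro!: sum.cong)
    also have "\<dots> = (\<Sum>e\<in>E. of_real (s e * (cmod (ip V x e))\<^sup>2))"
      using ip_sym[OF x EV] by (intro sum.cong) (auto simp: complex_norm_square simp del: of_real_power)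
    also have "\<dots> = of_real (\<Sum>e\<in>E. s e * (cmod (ip V x e))\<^sup>2)"
      by (rule of_real_sum[symmetric])
    finally show ?thesis
      using s(1) by (simp add: sum_nonneg del: of_real_sum)
  qed
  moreover have "R (R x) = x - Psi V T id x" if x: "x \<in> elts V" for x
  proof -
    have "R (R x) = (\<Sum>e\<in>E. (r e * ip V x e) *\<^sub>C e)"
      unfolding R_def[of "R x"]
    proof (intro sum.cong refl)
      fix e assume e: "e \<in> E"
      then have "ip V (R x) e = of_real (s e) * ip V x e"
        unfolding R_def by (rule ip_orthonormal_sum[OF E(1)])
      then show "(of_real (s e) * ip V (R x) e) *\<^sub>C e = (r e * ip V x e) *\<^sub>C e"
        using s(2)[OF e] by (simp add: mult.assoc[symmetric])
    qed
    also have "\<dots> = (\<Sum>e\<in>E. ip V (A x) e *\<^sub>C e)"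
    proof (intro sum.cong refl)
      fix e assume e: "e \<in> E"
      \<comment> \<open>The eigenvalue is the square of a real number, so it survives the
        conjugation that occurs when \<open>A\<close> moves across the inner product.\<close>
      have "cnj (r e) = r e"
        using s(2)[OF e] by (metis complex_cnj_complex_of_real complex_cnj_mult)
      then show "(r e * ip V x e) *\<^sub>C e = ip V (A x) e *\<^sub>C e"
        using x EV[OF e] by (simp add: A_selfadjoint r[OF e] ip_scale_right)
    qed
    also have "\<dots> = A x"
      using orthonormal_expansion[OF E(1)] E(2) A_D1[OF x] by simp
    finally show ?thesis
      by (simp add: A_def)
  qed
  ultimately show ?thesis
    unfolding positive_op_def by blast
qed

lemma D_positive: "positive_op V D" and DD: "x \<in> elts V \<Longrightarrow> D (D x) = A x"
  using someI_ex[OF ex_defect_op] by (auto simp: defect_op_def A_def)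

lemma D_in [simp]: "x \<in> elts V \<Longrightarrow> D x \<in> elts V"
  and D_add: "x \<in> elts V \<Longrightarrow> y \<in> elts V \<Longrightarrow> D (x + y) = D x + D y"
  and D_scale: "x \<in> elts V \<Longrightarrow> D (a *\<^sub>C x) = a *\<^sub>C D x"
  using D_positive by (auto simp: positive_op_def bounded_op_def)

lemmas D_selfadjoint = positive_op_selfadjoint[OF D_positive]

lemma D_sum: "(\<And>i. i \<in> I \<Longrightarrow> f i \<in> elts V) \<Longrightarrow> D (\<Sum>i\<in>I. f i) = (\<Sum>i\<in>I. D (f i))"
  using D_scale[of 0 0]
  by (induction I rule: infinite_finite_induct) (auto simp: D_add sum_in)

section \<open>An orthonormal basis of the first defect space\<close>

definition E :: "'v set" where "E = (SOME E. orthonormal E \<and> cspan E = D1)"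

lemma E_orthonormal: "orthonormal E" and cspan_E: "cspan E = D1"
proof -
  have "\<exists>E. orthonormal E \<and> cspan E = D1"
    using A_eigenbasis by blast
  then have "orthonormal E \<and> cspan E = D1"
    unfolding E_def by (rule someI_ex)
  then show "orthonormal E" "cspan E = D1"
    by blast+
qed

lemma finite_E [simp]: "finite E"
  using E_orthonormal by (simp add: orthonormal_def)

lemma E_elts [simp]: "e \<in> E \<Longrightarrow> e \<in> elts V"
  using E_orthonormal by (auto simp: orthonormal_def)

lemma E_D1: "e \<in> E \<Longrightarrow> e \<in> D1"
  using cspan_E complex_vector.span_base by blast

lemma D1_expansion: "x \<in> D1 \<Longrightarrow> x = (\<Sum>e\<in>E. ip V x e *\<^sub>C e)"
  using orthonormal_expansion[OF E_orthonormal] by (simp add: cspan_E)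

lemma Delta_1: "Delta V T 1 = enat (card E)"
  unfolding Delta_def cspan_E[symmetric] edim_cspan_finite[OF finite_E]
  using orthonormal_independent[OF E_orthonormal] by (simp add: complex_vector.dim_eq_card_independent)

text \<open>If \<open>y\<close> is orthogonal to the range of \<open>A\<close>, then
  \<open>ip V (D y) (D y) = ip V (A y) y = 0\<close>, so \<open>D y = 0\<close>, and by
  self-adjointness \<open>y\<close> is orthogonal to \<open>D x\<close>.\<close>

lemma D_in_D1: "x \<in> elts V \<Longrightarrow> D x \<in> D1"
proof -
  assume x: "x \<in> elts V"
  have "D x \<in> closure_in V (A ` elts V)"
  proof (rule mem_closure_inI[OF range_A_subspace])
    fix y assume y: "y \<in> elts V" and orth: "\<And>h. h \<in> A ` elts V \<Longrightarrow> ip V h y = 0"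
    have "ip V (D y) (D y) = ip V (A y) y"
      using y D_selfadjoint[of "D y" y] by (simp add: DD)
    also have "\<dots> = 0"
      using y by (intro orth) auto
    finally have "D y = 0"
      using y by (simp add: ip_self_eq_0)
    then show "ip V (D x) y = 0"
      using x y by (simp add: D_selfadjoint)
  qed (use x in auto)
  then show ?thesis
    by (simp only: D1_eq)
qed

lemma D_expansion:
  assumes "x \<in> elts V"
  shows "D x = (\<Sum>e\<in>E. ip V x (D e) *\<^sub>C e)"
proof -
  have "D x = (\<Sum>e\<in>E. ip V (D x) e *\<^sub>C e)"
    by (rule D1_expansion[OF D_in_D1[OF assms]])
  also have "\<dots> = (\<Sum>e\<in>E. ip V x (D e) *\<^sub>C e)"
    using assms by (intro sum.cong) (simp_all add: D_selfadjoint)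
  finally show ?thesis .
qed

section \<open>Generators of the higher defect spaces\<close>

primrec G :: "nat \<Rightarrow> 'v set" where
  "G 0 = {}"
| "G (Suc n) = D ` E \<union> (\<Union>i. T i ` G n)"

lemma finite_G: "finite (G n)"
  by (induction n) auto

lemma G_elts: "G n \<subseteq> elts V"
  by (induction n) auto

lemma T_cspan_G: "w \<in> cspan (G n) \<Longrightarrow> T i w \<in> cspan (G (Suc n))"
proof -
  assume "w \<in> cspan (G n)"
  then have "w \<in> elts V \<and> T i w \<in> cspan (G (Suc n))"
  proof (induction rule: complex_vector.span_induct_alt)
    case base
    then show ?case
      by (simp add: T_0 complex_vector.span_zero)
  next
    case (step c x y)
    have "x \<in> elts V"
      using step(1) G_elts by (rule rev_subsetD)
    moreover have "T i x \<in> cspan (G (Suc n))"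
      using step(1) by (intro complex_vector.span_base) auto
    ultimately show ?case
      using step(2) by (simp add: T_add T_scale complex_vector.span_add complex_vector.span_scale del: G.simps)
  qed
  then show ?thesis
    by simp
qed

text \<open>This is \<open>I - Psi^n(I)\<close>. Its range is matched with \<open>G n\<close>, the
  set of vectors obtained from the \<open>D e\<close> by applying words in the \<open>T i\<close> of
  length below \<open>n\<close>.\<close>

definition Q :: "nat \<Rightarrow> 'v \<Rightarrow> 'v" where "Q n x = x - (Psi V T ^^ n) id x"

lemma Q_0: "Q 0 x = 0"
  by (simp add: Q_def)

lemma Q_in: "x \<in> elts V \<Longrightarrow> Q n x \<in> elts V"
proof -
  have "x \<in> elts V \<Longrightarrow> (Psi V T ^^ n) id x \<in> elts V" for x
    by (induction n arbitrary: x) (auto simp: Psi_def intro!: sum_in)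
  then show "x \<in> elts V \<Longrightarrow> Q n x \<in> elts V"
    by (simp add: Q_def)
qed

text \<open>The identity \<open>I - Psi^(n+1)(I) = (I - Psi(I)) + Psi(I - Psi^n(I))\<close>, whose
  shape the recursion of \<open>G\<close> imitates.\<close>

lemma Q_Suc:
  assumes "x \<in> elts V"
  shows "Q (Suc n) x = A x + (\<Sum>i\<in>UNIV. T i (Q n (Ta i x)))"
proof -
  have "T i ((Psi V T ^^ n) id (Ta i x)) = T i (Ta i x) - T i (Q n (Ta i x))" for i
  proof -
    have "(Psi V T ^^ n) id (Ta i x) = Ta i x - Q n (Ta i x)"
      by (simp add: Q_def)
    then show ?thesis
      using assms by (simp add: T_diff Q_in)
  qed
  then have "(Psi V T ^^ Suc n) id x = (\<Sum>i\<in>UNIV. T i (Ta i x)) - (\<Sum>i\<in>UNIV. T i (Q n (Ta i x)))"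
    by (simp add: Psi_def sum_subtractf)
  then show ?thesis
    unfolding Q_def[of "Suc n"] A_eq by (simp only: diff_diff_eq2) (simp add: algebra_simps)
qed

lemma Q_linear:
  assumes "x \<in> elts V" "y \<in> elts V"
  shows "Q n (x + y) = Q n x + Q n y" "Q n (a *\<^sub>C x) = a *\<^sub>C Q n x"
proof -
  note Ta_linear = adj_linear[OF ips_axioms T_bounded]
  show "Q n (x + y) = Q n x + Q n y"
    using assms
    by (induction n arbitrary: x y)
      (auto simp: Q_0 Q_Suc Q_in A_add Ta_linear T_add sum.distrib)
  show "Q n (a *\<^sub>C x) = a *\<^sub>C Q n x"
    using assms(1)
    by (induction n arbitrary: x)
      (auto simp: Q_0 Q_Suc Q_in A_scale Ta_linear T_scale complex_vector.scale_sum_right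
        complex_vector.scale_right_distrib)
qed

lemma range_Q_subspace: "csubspace (Q n ` elts V)"
proof (rule complex_vector.subspaceI)
  show "0 \<in> Q n ` elts V"
    using Q_linear(2)[of 0 0 n 0] by (auto intro!: image_eqI[of _ _ 0])
qed (auto simp: Q_linear[symmetric])

text \<open>\<open>A x\<close> is \<open>D\<close> applied to a vector of \<open>D1\<close>, hence a
  combination of the \<open>D e\<close>; the other terms of the recursion are handled by
  \<open>T_cspan_G\<close>.\<close>

lemma Q_in_cspan: "x \<in> elts V \<Longrightarrow> Q n x \<in> cspan (G n)"
proof (induction n arbitrary: x)
  case 0
  then show ?case
    by (simp add: Q_0)
next
  case (Suc n)
  have "A x = D (\<Sum>e\<in>E. ip V (D x) e *\<^sub>C e)"
    using D1_expansion[OF D_in_D1] Suc.prems by (simp add: DD)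
  also have "\<dots> = (\<Sum>e\<in>E. ip V (D x) e *\<^sub>C D e)"
    by (simp add: D_sum D_scale)
  also have "\<dots> \<in> cspan (G (Suc n))"
    by (intro complex_vector.span_sum complex_vector.span_scale complex_vector.span_base) auto
  finally show ?case
    using Suc by (simp add: Q_Suc complex_vector.span_add complex_vector.span_sum T_cspan_G del: G.simps)
qed

text \<open>By the recursion, the quadratic form of \<open>Q (Suc n)\<close> at \<open>x\<close> is
  the squared norm of \<open>D x\<close> plus the forms of \<open>Q n\<close> at the vectors
  \<open>Ta i x\<close>. Nonnegativity is carried along in the induction because a vanishing sum
  forces each term to vanish only if no term is negative.\<close>

lemma Q_positive:
  assumes "x \<in> elts V"
  shows "0 \<le> Re (ip V (Q n x) x) \<and> (Re (ip V (Q n x) x) = 0 \<longrightarrow> (\<forall>w\<in>G n. ip V w x = 0))"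
  using assms
proof (induction n arbitrary: x)
  case (Suc n)
  note x = \<open>x \<in> elts V\<close>
  have "ip V (Q (Suc n) x) x = ip V (D x) (D x) + (\<Sum>i\<in>UNIV. ip V (Q n (Ta i x)) (Ta i x))"
    using x D_selfadjoint[of "D x" x]
    by (simp add: Q_Suc Q_in ip_add_left sum_in ip_sum_left ip_Ta DD)
  then have eq: "Re (ip V (Q (Suc n) x) x) =
      Re (ip V (D x) (D x)) + (\<Sum>i\<in>UNIV. Re (ip V (Q n (Ta i x)) (Ta i x)))"
    by simp
  have nn: "0 \<le> Re (ip V (D x) (D x))" "\<And>i. 0 \<le> Re (ip V (Q n (Ta i x)) (Ta i x))"
    using Suc.IH x by (auto intro: Re_ip_self_nonneg)
  then have s: "0 \<le> (\<Sum>i\<in>UNIV. Re (ip V (Q n (Ta i x)) (Ta i x)))"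
    by (intro sum_nonneg) auto
  have "\<forall>w\<in>G (Suc n). ip V w x = 0" if "Re (ip V (Q (Suc n) x) x) = 0"
  proof -
    have "Re (ip V (D x) (D x)) = 0" "(\<Sum>i\<in>UNIV. Re (ip V (Q n (Ta i x)) (Ta i x))) = 0"
      using that nn(1) s unfolding eq by linarith+
    then have Dx: "D x = 0" and z: "\<And>i. Re (ip V (Q n (Ta i x)) (Ta i x)) = 0"
      using ip_pos[of "D x"] nn x by (auto simp: sum_nonneg_eq_0_iff)
    have "ip V (D e) x = 0" if "e \<in> E" for e
      using that x Dx by (simp add: D_selfadjoint)
    moreover have "ip V (T i w) x = 0" if w: "w \<in> G n" for i w
    proof -
      have "ip V w (Ta i x) = 0"
        using Suc.IH[of "Ta i x"] z[of i] w x by simp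
      then show ?thesis
        using w x G_elts[of n] by (simp add: ip_Ta subset_iff)
    qed
    ultimately show ?thesis
      by auto
  qed
  then show ?case
    using nn(1) s eq by simp
qed (auto simp: Q_0)

text \<open>The operator \<open>Q n\<close> is a sum of squares of the adjoints of the operators spanning \<open>G n\<close>, hence its kernel
  is the orthogonal complement of \<open>G n\<close>.\<close>

theorem defect_space_eq_cspan: "defect_space V T n = cspan (G n)"
proof -
  have eq: "defect_space V T n = closure_in V (Q n ` elts V)"
    by (simp add: defect_space_def Q_def[abs_def])
  have QV: "Q n ` elts V \<subseteq> elts V"
    using Q_in by auto
  have GV: "cspan (G n) \<subseteq> elts V"
    by (intro cspan_subset_elts G_elts)
  have "cspan (G n) \<subseteq> closure_in V (Q n ` elts V)"
  proof (rule complex_vector.span_minimal)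
    show "csubspace (closure_in V (Q n ` elts V))"
      by (intro subspace_closure_in range_Q_subspace QV)
    show "G n \<subseteq> closure_in V (Q n ` elts V)"
    proof
      fix w assume w: "w \<in> G n"
      show "w \<in> closure_in V (Q n ` elts V)"
      proof (rule mem_closure_inI[OF range_Q_subspace QV])
        show "w \<in> elts V"
          using w G_elts by blast
        \<comment> \<open>Testing with \<open>h = Q n y\<close> makes the quadratic form of
          \<open>Q n\<close> vanish at \<open>y\<close>; \<open>Q_positive\<close> turns this into
          orthogonality to \<open>G n\<close>.\<close>
        fix y assume y: "y \<in> elts V" and "\<And>h. h \<in> Q n ` elts V \<Longrightarrow> ip V h y = 0"
        then have "ip V (Q n y) y = 0"
          by blast
        then show "ip V w y = 0"
          using Q_positive[OF y, of n] w by simp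
      qed
    qed
  qed
  moreover have "closure_in V (Q n ` elts V) \<subseteq> cspan (G n)"
  proof -
    \<comment> \<open>The eigenbasis lemma is applied to the identity: an orthonormal basis is what
      shows that the span of the finite set \<open>G n\<close> is closed.\<close>
    obtain F where F: "orthonormal F" "cspan F = cspan (G n)"
      using orthonormal_eigenbasis[OF complex_vector.subspace_span GV finite_G order_refl, of "\<lambda>x. x"]
      by (metis complex_vector.scale_one)
    have "Q n ` elts V \<subseteq> cspan (G n)"
      using Q_in_cspan by auto
    then have "closure_in V (Q n ` elts V) \<subseteq> closure_in V (cspan (G n))"
      unfolding closure_in_def by blast
    also have "\<dots> = cspan (G n)"
      using closure_in_cspan_orthonormal[OF F(1)] by (simp add: F(2))
    finally show ?thesis .
  qed
  ultimately show ?thesis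
    by (simp add: eq)
qed

end

section \<open>Monomials on the ball\<close>

text \<open>Stars and bars: an enumeration of the index type turns multi-indices into lists of
  length \<open>CARD('d)\<close>, and those of given sum are counted by
  \<open>card_length_sum_list\<close>.\<close>

lemma card_weight_eq:
  "finite {a :: 'd::finite \<Rightarrow> nat. sum a UNIV = k}"
  "card {a :: 'd::finite \<Rightarrow> nat. sum a UNIV = k} = (k + CARD('d) - 1) choose (CARD('d) - 1)"
proof -
  obtain xs :: "'d list" where xs: "set xs = UNIV" "distinct xs"
    using finite_distinct_list[of "UNIV :: 'd set"] by auto
  have len: "length xs = CARD('d)"
    using xs distinct_card by metis
  have bij: "bij_betw (\<lambda>a. map a xs) {a :: 'd \<Rightarrow> nat. sum a UNIV = k} {l. size l = CARD('d) \<and> sum_list l = k}"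
    unfolding bij_betw_def
  proof (intro conjI inj_onI equalityI subsetI)
    fix a b :: "'d \<Rightarrow> nat" assume "map a xs = map b xs"
    then show "a = b"
      using xs by (auto simp: fun_eq_iff)
  next
    fix l assume "l \<in> (\<lambda>a. map a xs) ` {a :: 'd \<Rightarrow> nat. sum a UNIV = k}"
    then show "l \<in> {l. size l = CARD('d) \<and> sum_list l = k}"
      using xs len by (auto simp: sum_list_distinct_conv_sum_set)
  next
    fix l :: "nat list" assume l: "l \<in> {l. size l = CARD('d) \<and> sum_list l = k}"
    define a where "a = (\<lambda>i. the (map_of (zip xs l) i))"
    have "map a xs = l"
      using l xs len by (intro nth_equalityI) (auto simp: a_def map_of_zip_nth)
    moreover from this have "sum a UNIV = k"
      using l xs sum_list_distinct_conv_sum_set[of xs a] by auto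
    ultimately show "l \<in> (\<lambda>a. map a xs) ` {a :: 'd \<Rightarrow> nat. sum a UNIV = k}"
      by auto
  qed
  have "finite {l :: nat list. set l \<subseteq> {..k} \<and> length l = CARD('d)}"
    by (rule finite_lists_length_eq) simp
  moreover have "{l. size l = CARD('d) \<and> sum_list l = k} \<subseteq> {l. set l \<subseteq> {..k} \<and> length l = CARD('d)}"
    by (auto intro: member_le_sum_list)
  ultimately have "finite {l :: nat list. size l = CARD('d) \<and> sum_list l = k}"
    by (rule rev_finite_subset)
  then show "finite {a :: 'd \<Rightarrow> nat. sum a UNIV = k}"
    using bij_betw_finite[OF bij] by simp
  have "card {a :: 'd \<Rightarrow> nat. sum a UNIV = k} = (k + CARD('d) - 1) choose k"
    using bij_betw_same_card[OF bij] by (simp add: card_length_sum_list)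
  also have "\<dots> = (k + CARD('d) - 1) choose (CARD('d) - 1)"
  proof -
    \<comment> \<open>Writing the positive number \<open>CARD('d)\<close> as a successor removes the
      truncated subtractions before the symmetry of binomial coefficients is applied.\<close>
    obtain m where "CARD('d) = Suc m"
      using zero_less_card_finite[where 'a = 'd] gr0_implies_Suc by blast
    then show ?thesis
      using binomial_symmetric[of k "k + m"] by simp
  qed
  finally show "card {a :: 'd \<Rightarrow> nat. sum a UNIV = k} = (k + CARD('d) - 1) choose (CARD('d) - 1)" .
qed

lemma card_weight_less:
  "finite {a :: 'd::finite \<Rightarrow> nat. sum a UNIV < n}"
  "card {a :: 'd::finite \<Rightarrow> nat. sum a UNIV < n} = (\<Sum>k<n. (k + CARD('d) - 1) choose (CARD('d) - 1))"
proof -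
  have eq: "{a :: 'd \<Rightarrow> nat. sum a UNIV < n} = (\<Union>k<n. {a. sum a UNIV = k})"
    by auto
  show "finite {a :: 'd \<Rightarrow> nat. sum a UNIV < n}"
    unfolding eq by (simp add: card_weight_eq)
  show "card {a :: 'd \<Rightarrow> nat. sum a UNIV < n} = (\<Sum>k<n. (k + CARD('d) - 1) choose (CARD('d) - 1))"
    unfolding eq by (subst card_UN_disjoint) (auto simp: card_weight_eq)
qed

text \<open>Reduction modulo the base \<open>N\<close> isolates the lowest digit; the others follow
  by induction.\<close>

lemma digits_unique:
  fixes f g :: "nat \<Rightarrow> nat"
  assumes "\<And>j. j < m \<Longrightarrow> f j < N" "\<And>j. j < m \<Longrightarrow> g j < N"
    and "(\<Sum>j<m. f j * N ^ j) = (\<Sum>j<m. g j * N ^ j)"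
  shows "j < m \<Longrightarrow> f j = g j"
  using assms
proof (induction m arbitrary: f g j)
  case (Suc m)
  have split: "(\<Sum>j<Suc m. h j * N ^ j) = h 0 + N * (\<Sum>j<m. h (Suc j) * N ^ j)" for h :: "nat \<Rightarrow> nat"
    by (simp add: sum.lessThan_Suc_shift sum_distrib_left mult_ac del: sum.lessThan_Suc)
  have lt: "f 0 < N" "g 0 < N"
    using Suc.prems by auto
  have eq: "f 0 + N * (\<Sum>j<m. f (Suc j) * N ^ j) = g 0 + N * (\<Sum>j<m. g (Suc j) * N ^ j)"
    using Suc.prems(4) by (simp only: split)
  then have "(f 0 + N * (\<Sum>j<m. f (Suc j) * N ^ j)) mod N = (g 0 + N * (\<Sum>j<m. g (Suc j) * N ^ j)) mod N"
    by simp
  then have 0: "f 0 = g 0"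
    using lt by simp
  then have "(\<Sum>j<m. f (Suc j) * N ^ j) = (\<Sum>j<m. g (Suc j) * N ^ j)"
    using eq lt by auto
  then have "f (Suc i) = g (Suc i)" if "i < m" for i
    using Suc.IH[of i "\<lambda>j. f (Suc j)" "\<lambda>j. g (Suc j)"] Suc.prems that by auto
  then show ?case
    using 0 Suc.prems(1) by (cases j) auto
qed simp

definition mono_fun :: "('d::finite \<Rightarrow> nat) \<Rightarrow> 'd unit_ball \<Rightarrow> complex" where
  "mono_fun a = (\<lambda>z. \<Prod>i\<in>UNIV. (vec_of z $ i) ^ a i)"

lemma polys_eq: "polys = cspan (range mono_fun)"
  by (simp add: polys_def mono_fun_def[abs_def])

lemma mono_fun_0: "mono_fun (\<lambda>_. 0) = 1"
  by (simp add: mono_fun_def fun_eq_iff)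

lemma mono_fun_Suc: "mono_fun (a(i := Suc (a i))) = Mz i (mono_fun a)"
proof
  fix z :: "'a unit_ball"
  have "(\<Prod>j\<in>UNIV - {i}. (vec_of z $ j) ^ (a(i := Suc (a i))) j) = (\<Prod>j\<in>UNIV - {i}. (vec_of z $ j) ^ a j)"
    by (intro prod.cong) auto
  then show "mono_fun (a(i := Suc (a i))) z = Mz i (mono_fun a) z"
    by (simp add: mono_fun_def Mz_def prod.remove[of UNIV i])
qed

lemma weight_Suc: "sum (a(i := Suc (a i))) UNIV = Suc (sum a (UNIV :: 'd::finite set))"
proof -
  have "(\<Sum>j\<in>UNIV - {i}. (a(i := Suc (a i))) j) = (\<Sum>j\<in>UNIV - {i}. a j)"
    by (intro sum.cong) auto
  then show ?thesis
    by (simp add: sum.remove[of UNIV i])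
qed

lemma weight_SucE:
  fixes a :: "'d::finite \<Rightarrow> nat"
  assumes "sum a UNIV = Suc k"
  obtains b i where "a = b(i := Suc (b i))" "sum b UNIV = k"
proof -
  obtain i where i: "a i \<noteq> 0"
    using assms by (metis sum.neutral nat.distinct(1))
  define b where "b = a(i := a i - 1)"
  have a: "a = b(i := Suc (b i))"
    using i by (auto simp: b_def)
  then have "sum b UNIV = k"
    using assms weight_Suc[of b i] by simp
  then show thesis
    using a that by blast
qed

text \<open>Kronecker substitution: along the curve \<open>z\<^sub>i = t\<^bsup>N^i\<^esup>\<close> distinct monomials of degree below \<open>N\<close> become
  distinct powers of \<open>t\<close>.\<close>

lemma mono_fun_independent:
  fixes c :: "('d::finite \<Rightarrow> nat) \<Rightarrow> complex"
  assumes F: "finite F" and rel: "(\<Sum>a\<in>F. c a *\<^sub>C mono_fun a) = 0" and b: "b \<in> F"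
  shows "c b = 0"
proof -
  obtain h where h: "bij_betw h {0..<CARD('d)} (UNIV :: 'd set)"
    using ex_bij_betw_nat_finite[of "UNIV :: 'd set"] by auto
  \<comment> \<open>\<open>N\<close> exceeds every exponent of every monomial in \<open>F\<close>,
    so exponents can serve as base \<open>N\<close> digits.\<close>
  define N where "N = Suc (\<Sum>a\<in>F. \<Sum>i\<in>UNIV. a i)"
  have N: "a i < N" if "a \<in> F" for a i
  proof -
    have "a i \<le> (\<Sum>i\<in>UNIV. a i)"
      by (rule member_le_sum) auto
    also have "\<dots> \<le> (\<Sum>a\<in>F. \<Sum>i\<in>UNIV. a i)"
      using that F by (intro member_le_sum[of a F "\<lambda>a. \<Sum>i\<in>UNIV. a i"]) auto
    finally show ?thesis
      by (simp add: N_def)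
  qed
  define h' where "h' = the_inv_into {0..<CARD('d)} h"
  have h'h: "h' (h j) = j" if "j < CARD('d)" for j
    using that h by (auto simp: h'_def bij_betw_def intro!: the_inv_into_f_f)
  define w where "w a = (\<Sum>i\<in>UNIV. a i * N ^ h' i)" for a :: "'d \<Rightarrow> nat"
  have w: "w a = (\<Sum>j<CARD('d). a (h j) * N ^ j)" for a
    unfolding w_def using sum.reindex_bij_betw[OF h, of "\<lambda>i. a i * N ^ h' i"]
    by (simp add: atLeast0LessThan h'h)
  have w_inj: "a = a'" if "a \<in> F" "a' \<in> F" "w a = w a'" for a a'
  proof
    fix i
    obtain j where j: "j < CARD('d)" "i = h j"
      using h by (metis UNIV_I atLeastLessThan_iff bij_betw_imp_surj_on imageE)
    then show "a i = a' i"
      using digits_unique[of "CARD('d)" "\<lambda>j. a (h j)" N "\<lambda>j. a' (h j)" j] that N by (auto simp: w)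
  qed
  define p where "p = (\<Sum>a\<in>F. monom (c a) (w a))"
  \<comment> \<open>With each of the \<open>CARD('d)\<close> coordinates bounded by this value, the
    curve stays inside the unit ball.\<close>
  define \<epsilon> where "\<epsilon> = 1 / (real CARD('d) + 1)"
  have \<epsilon>: "0 < \<epsilon>" "\<epsilon> < 1" "real CARD('d) * \<epsilon> < 1"
    using zero_less_card_finite[where 'a = 'd] by (auto simp: \<epsilon>_def field_simps)
  have root: "poly p (of_real t) = 0" if t: "0 < t" "t < \<epsilon>" for t
  proof -
    define v :: "complex ^ 'd" where "v = (\<chi> i. of_real (t ^ (N ^ h' i)))"
    have "norm v \<le> (\<Sum>i\<in>UNIV. cmod (v $ i))"
      by (simp add: norm_vec_def L2_set_le_sum)
    also have "\<dots> \<le> (\<Sum>i\<in>(UNIV :: 'd set). \<epsilon>)"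
    proof (rule sum_mono)
      fix i
      have "t ^ (N ^ h' i) \<le> t ^ 1"
        using t \<epsilon> by (intro power_decreasing) (auto simp: N_def)
      then show "cmod (v $ i) \<le> \<epsilon>"
        using t by (simp add: v_def norm_power)
    qed
    also have "\<dots> < 1"
      using \<epsilon> by simp
    finally have "vec_of (to_ball v) = v"
      by (intro to_ball_inverse) auto
    then have mono: "mono_fun a (to_ball v) = of_real t ^ w a" for a
      by (simp add: mono_fun_def v_def w_def power_sum mult.commute flip: power_mult)
    have "0 = (\<Sum>a\<in>F. c a *\<^sub>C mono_fun a) (to_ball v)"
      using rel by simp
    also have "\<dots> = (\<Sum>a\<in>F. c a * of_real t ^ w a)"
      using F by (induction F) (auto simp: scaleC_fun_def scaleC_complex_def mono)
    finally show ?thesis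
      by (simp add: p_def poly_sum poly_monom)
  qed
  have "p = 0"
  proof (rule ccontr)
    assume "p \<noteq> 0"
    then have "finite {x. poly p x = 0}"
      by (rule poly_roots_finite)
    moreover have "of_real ` {0<..<\<epsilon>} \<subseteq> {x. poly p x = 0}"
      using root by auto
    ultimately have "finite ((of_real :: real \<Rightarrow> complex) ` {0<..<\<epsilon>})"
      by (rule rev_finite_subset)
    then have "finite {0<..<\<epsilon>}"
      by (rule finite_imageD) (simp add: inj_on_def)
    then show False
      using \<epsilon> by (simp add: infinite_Ioo)
  qed
  then have "0 = coeff p (w b)"
    by simp
  also have "\<dots> = (\<Sum>a\<in>F. if a = b then c a else 0)"
    unfolding p_def coeff_sum using w_inj b by (intro sum.cong) auto
  also have "\<dots> = c b"
    using F b by simp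
  finally show ?thesis
    by simp
qed

section \<open>The Drury-Arveson space\<close>

lemma Mz_add: "Mz i (f + g) = Mz i f + Mz i g"
  and Mz_scale: "Mz i (a *\<^sub>C f) = a *\<^sub>C Mz i f"
  by (auto simp: Mz_def fun_eq_iff scaleC_fun_def scaleC_complex_def distrib_left)

lemma fun_sum_apply: "(\<Sum>i\<in>I. f i) x = (\<Sum>i\<in>I. f i x)"
  by (induction I rule: infinite_finite_induct) auto

definition sp :: "'d::finite unit_ball \<Rightarrow> 'd unit_ball \<Rightarrow> complex" where
  "sp z l = (\<Sum>j\<in>UNIV. vec_of z $ j * cnj (vec_of l $ j))"

lemma norm_vec_of: "norm (vec_of z) < 1"
  using vec_of[of z] by simp

lemma sp_less_1: "cmod (sp z l) < 1"
proof -
  have "cmod (sp z l) \<le> (\<Sum>j\<in>UNIV. \<bar>cmod (vec_of z $ j)\<bar> * \<bar>cmod (vec_of l $ j)\<bar>)"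
    unfolding sp_def by (rule sum_norm_le) (simp add: norm_mult)
  also have "\<dots> \<le> norm (vec_of z) * norm (vec_of l)"
    unfolding norm_vec_def by (rule L2_set_mult_ineq)
  also have "\<dots> < 1"
    using norm_vec_of[of z] norm_vec_of[of l] mult_strict_mono[of "norm (vec_of z)" 1 "norm (vec_of l)" 1]
    by simp
  finally show ?thesis .
qed

text \<open>The multiplicative form of the kernel formula, on which both contractivity and the
  factorization of the kernel of the submodule rest.\<close>

lemma DA_kernel_sp: "(1 - sp z l) * DA_kernel l z = 1"
proof -
  have "sp z l \<noteq> 1"
    using sp_less_1[of z l] by auto
  then show ?thesis
    by (simp add: DA_kernel_def sp_def[symmetric])
qed

context ips
begin

lemma ip_sum_sum:
  assumes "\<And>l. l \<in> I \<Longrightarrow> b l \<in> elts V"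
  shows "ip V (\<Sum>l\<in>I. c l *\<^sub>C b l) (\<Sum>l\<in>I. c l *\<^sub>C b l) = (\<Sum>l\<in>I. \<Sum>m\<in>I. c l * cnj (c m) * ip V (b l) (b m))"
proof -
  have "ip V (\<Sum>l\<in>I. c l *\<^sub>C b l) (\<Sum>l\<in>I. c l *\<^sub>C b l) = (\<Sum>l\<in>I. ip V (c l *\<^sub>C b l) (\<Sum>m\<in>I. c m *\<^sub>C b m))"
    using assms by (intro ip_sum_left sum_in) auto
  also have "\<dots> = (\<Sum>l\<in>I. \<Sum>m\<in>I. ip V (c l *\<^sub>C b l) (c m *\<^sub>C b m))"
    using assms by (intro sum.cong refl ip_sum_right) auto
  also have "\<dots> = (\<Sum>l\<in>I. \<Sum>m\<in>I. c l * cnj (c m) * ip V (b l) (b m))"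
    using assms by (intro sum.cong refl) (simp add: ip_scale_left ip_scale_right mult_ac)
  finally show ?thesis .
qed

end

locale drury_arveson = hilbert H for H :: "('d::finite unit_ball \<Rightarrow> complex) ip_space" +
  assumes DA: "is_drury_arveson H"
begin

lemma kernel_in [simp]: "DA_kernel l \<in> elts H"
  and ip_kernel: "f \<in> elts H \<Longrightarrow> ip H f (DA_kernel l) = f l"
  using DA by (auto simp: is_drury_arveson_def is_rkhs_def)

text \<open>This is the estimate that \<open>Riesz_family\<close> asks for. \<open>L i\<close> is
  the vector into which the adjoint of multiplication by \<open>z_i\<close> would send
  \<open>h\<close>; it is written down directly because the multiplication is not yet known to act
  on \<open>H\<close>.\<close>

lemma row_contraction_aux:
  fixes c :: "'d unit_ball \<Rightarrow> complex"
  assumes f: "\<And>i. f i \<in> elts H"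
  shows "cmod (\<Sum>l\<in>I. c l * cnj (\<Sum>i\<in>UNIV. vec_of l $ i * f i l))
    \<le> sqrt (\<Sum>i\<in>UNIV. (nrm H (f i))\<^sup>2) * nrm H (\<Sum>l\<in>I. c l *\<^sub>C DA_kernel l)"
proof -
  define h where "h = (\<Sum>l\<in>I. c l *\<^sub>C DA_kernel l)"
  define L where "L i = (\<Sum>l\<in>I. (c l * cnj (vec_of l $ i)) *\<^sub>C DA_kernel l)" for i
  have hH: "h \<in> elts H" and LH: "L i \<in> elts H" for i
    unfolding h_def L_def by (auto intro: sum_in)
  have "ip H (L i) (f i) = (\<Sum>l\<in>I. c l * cnj (vec_of l $ i * f i l))" for i
  proof -
    have "ip H (DA_kernel l) (f i) = cnj (f i l)" for l
      using ip_sym[OF f[of i] kernel_in[of l]] f[of i] by (simp add: ip_kernel)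
    then show ?thesis
      unfolding L_def using f[of i] by (subst ip_sum_left) (auto simp: ip_scale_left mult_ac intro!: sum.cong)
  qed
  then have "(\<Sum>l\<in>I. c l * cnj (\<Sum>i\<in>UNIV. vec_of l $ i * f i l)) = (\<Sum>i\<in>UNIV. ip H (L i) (f i))"
    by (simp add: sum_distrib_left sum.swap[of _ I])
  also have "cmod \<dots> \<le> (\<Sum>i\<in>UNIV. \<bar>nrm H (L i)\<bar> * \<bar>nrm H (f i)\<bar>)"
    using Cauchy_Schwarz LH f by (intro sum_norm_le) simp
  also have "\<dots> \<le> L2_set (\<lambda>i. nrm H (L i)) UNIV * L2_set (\<lambda>i. nrm H (f i)) UNIV"
    by (rule L2_set_mult_ineq)
  also have "\<dots> \<le> nrm H h * sqrt (\<Sum>i\<in>UNIV. (nrm H (f i))\<^sup>2)"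
  proof -
    have "(\<Sum>i\<in>UNIV. ip H (L i) (L i)) =
        (\<Sum>l\<in>I. \<Sum>m\<in>I. c l * cnj (c m) * (sp m l * ip H (DA_kernel l) (DA_kernel m)))"
      unfolding L_def
      by (simp add: ip_sum_sum sp_def sum_distrib_left sum_distrib_right sum.swap[of _ I UNIV] mult_ac)
    moreover have "ip H h h = (\<Sum>l\<in>I. \<Sum>m\<in>I. c l * cnj (c m) * ip H (DA_kernel l) (DA_kernel m))"
      unfolding h_def by (simp add: ip_sum_sum)
    \<comment> \<open>The factor \<open>1 - sp m l\<close> cancels the kernel, so the double sum
      factorizes into the squared modulus of the sum of the \<open>c l\<close>.\<close>
    ultimately have "ip H h h - (\<Sum>i\<in>UNIV. ip H (L i) (L i)) =
      (\<Sum>l\<in>I. \<Sum>m\<in>I. c l * cnj (c m) * ((1 - sp m l) * ip H (DA_kernel l) (DA_kernel m)))"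
      by (simp add: algebra_simps sum_subtractf)
    also have "\<dots> = (\<Sum>l\<in>I. c l) * cnj (\<Sum>m\<in>I. c m)"
      by (simp add: ip_kernel DA_kernel_sp sum_product)
    also have "\<dots> = of_real ((cmod (\<Sum>l\<in>I. c l))\<^sup>2)"
      by (rule complex_norm_square[symmetric])
    finally have "ip H h h - (\<Sum>i\<in>UNIV. ip H (L i) (L i)) = of_real ((cmod (\<Sum>l\<in>I. c l))\<^sup>2)" .
    from arg_cong[OF this, of Re]
    have "(nrm H h)\<^sup>2 - (\<Sum>i\<in>UNIV. (nrm H (L i))\<^sup>2) = (cmod (\<Sum>l\<in>I. c l))\<^sup>2"
      using hH LH by (simp add: nrm_sq)
    then have "(\<Sum>i\<in>UNIV. (nrm H (L i))\<^sup>2) \<le> (nrm H h)\<^sup>2"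
      using zero_le_power2[of "cmod (\<Sum>l\<in>I. c l)"] by linarith
    then have "L2_set (\<lambda>i. nrm H (L i)) UNIV \<le> nrm H h"
      using hH by (simp add: L2_set_def real_le_lsqrt)
    then show ?thesis
      unfolding L2_set_def[of "\<lambda>i. nrm H (f i)"] by (intro mult_right_mono) (auto intro: sum_nonneg)
  qed
  finally show ?thesis
    by (simp add: h_def mult.commute)
qed

text \<open>\<open>H\<close> is accessible through its kernel, so membership of the sum has to be
  proved together with the bound: the function is found as the vector with prescribed inner products
  against the kernel functions.\<close>

lemma row_contraction:
  assumes f: "\<And>i. f i \<in> elts H"
  shows "(\<Sum>i\<in>UNIV. Mz i (f i)) \<in> elts H"
    and "(nrm H (\<Sum>i\<in>UNIV. Mz i (f i)))\<^sup>2 \<le> (\<Sum>i\<in>UNIV. (nrm H (f i))\<^sup>2)"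
proof -
  have nn: "0 \<le> sqrt (\<Sum>i\<in>UNIV. (nrm H (f i))\<^sup>2)"
    by (simp add: sum_nonneg)
  have "\<exists>v\<in>elts H. nrm H v \<le> sqrt (\<Sum>i\<in>UNIV. (nrm H (f i))\<^sup>2) \<and>
      (\<forall>l. ip H (DA_kernel l) v = cnj (\<Sum>i\<in>UNIV. vec_of l $ i * f i l))"
    by (rule Riesz_family[OF nn kernel_in row_contraction_aux[OF f]])
  then obtain v where v: "v \<in> elts H" "nrm H v \<le> sqrt (\<Sum>i\<in>UNIV. (nrm H (f i))\<^sup>2)"
    and ip_v: "\<And>l. ip H (DA_kernel l) v = cnj (\<Sum>i\<in>UNIV. vec_of l $ i * f i l)"
    by blast
  have "v l = (\<Sum>i\<in>UNIV. Mz i (f i)) l" for l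
    using ip_sym[OF kernel_in v(1), of l] ip_v[of l] v(1)
    by (simp add: ip_kernel fun_sum_apply Mz_def)
  then have eq: "v = (\<Sum>i\<in>UNIV. Mz i (f i))"
    by blast
  then show "(\<Sum>i\<in>UNIV. Mz i (f i)) \<in> elts H"
    using v by simp
  have "(nrm H v)\<^sup>2 \<le> (sqrt (\<Sum>i\<in>UNIV. (nrm H (f i))\<^sup>2))\<^sup>2"
    using v by (intro power_mono) auto
  then show "(nrm H (\<Sum>i\<in>UNIV. Mz i (f i)))\<^sup>2 \<le> (\<Sum>i\<in>UNIV. (nrm H (f i))\<^sup>2)"
    by (simp add: eq sum_nonneg)
qed

text \<open>Apply \<open>row_contraction\<close> to a row with one nonzero entry.\<close>

lemma Mz_in: "f \<in> elts H \<Longrightarrow> Mz i f \<in> elts H"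
  and Mz_nrm: "f \<in> elts H \<Longrightarrow> nrm H (Mz i f) \<le> nrm H f"
proof -
  assume f: "f \<in> elts H"
  define g where "g j = (if j = i then f else 0)" for j
  have g: "g j \<in> elts H" for j
    using f by (simp add: g_def)
  have "Mz j (g j) = (if j = i then Mz i f else 0)" for j
    by (simp add: g_def Mz_def fun_eq_iff)
  then have "(\<Sum>j\<in>UNIV. Mz j (g j)) = Mz i f"
    by simp
  moreover have "(\<Sum>j\<in>UNIV. (nrm H (g j))\<^sup>2) = (nrm H f)\<^sup>2"
  proof -
    have "(nrm H (g j))\<^sup>2 = (if j = i then (nrm H f)\<^sup>2 else 0)" for j
      by (simp add: g_def)
    then show ?thesis
      by simp
  qed
  ultimately have "Mz i f \<in> elts H" "(nrm H (Mz i f))\<^sup>2 \<le> (nrm H f)\<^sup>2"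
    using row_contraction[of g] g by auto
  then show "Mz i f \<in> elts H" "nrm H (Mz i f) \<le> nrm H f"
    using f by (auto intro: power2_le_imp_le)
qed

lemma mono_fun_in: "mono_fun a \<in> elts H"
proof (induction "sum a UNIV" arbitrary: a)
  case 0
  \<comment> \<open>The constant 1 is the kernel function at the origin.\<close>
  have "vec_of (to_ball 0 :: 'd unit_ball) = 0"
    by (rule to_ball_inverse) simp
  then have "DA_kernel (to_ball 0 :: 'd unit_ball) = 1"
    by (simp add: DA_kernel_def fun_eq_iff)
  moreover have "a = (\<lambda>_. 0)"
    using 0 by auto
  ultimately have "mono_fun a = DA_kernel (to_ball 0 :: 'd unit_ball)"
    using mono_fun_0 by metis
  then show ?case
    by simp
next
  case (Suc k)
  obtain b i where "a = b(i := Suc (b i))" "sum b UNIV = k"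
    using Suc.hyps(2) by (metis weight_SucE)
  then show ?case
    using Suc.hyps(1)[of b] by (simp add: mono_fun_Suc Mz_in)
qed

lemma polys_subset: "polys \<subseteq> elts H"
  unfolding polys_eq by (intro cspan_subset_elts) (auto simp: mono_fun_in)

end

section \<open>Submodules of the Drury-Arveson space\<close>

lemma elts_update [simp]: "elts (H\<lparr>elts := S\<rparr>) = S" and ip_update [simp]: "ip (H\<lparr>elts := S\<rparr>) = ip H"
  by simp_all

locale da_submodule = drury_arveson H for H :: "('d::finite unit_ball \<Rightarrow> complex) ip_space" +
  fixes S :: "('d unit_ball \<Rightarrow> complex) set"
  assumes submodule: "submodule H S"
begin

lemma S_closed: "closed_csubspace H S"
  using submodule by (simp add: submodule_def)

lemma S_elts: "f \<in> S \<Longrightarrow> f \<in> elts H"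
  using S_closed by (auto simp: closed_csubspace_def)

lemma Mz_S: "f \<in> S \<Longrightarrow> Mz i f \<in> S"
  using submodule by (simp add: submodule_def)

abbreviation "V \<equiv> H\<lparr>elts := S\<rparr>"

sublocale V: hilbert V
  by (rule restrict_closed[OF S_closed])

lemma Mz_bounded: "bounded_op V V (Mz i)"
  unfolding bounded_op_def
  by (auto simp: Mz_S Mz_add Mz_scale intro!: exI[of _ 1] Mz_nrm[OF S_elts])

lemma Mz_commuting: "commuting_tuple V Mz"
  by (simp add: commuting_tuple_def Mz_def fun_eq_iff mult_ac)

text \<open>\<open>row_contraction\<close> bounds a row operator, whereas contractivity concerns its
  adjoint, taken within \<open>S\<close>. For \<open>c\<close> the sum of the squared norms of the
  \<open>adj V V (Mz i) x\<close>, Cauchy-Schwarz gives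
  \<open>c \<le> nrm H (B x) * nrm H x\<close>, and the row bound gives
  \<open>(nrm H (B x))^2 \<le> c\<close>; hence \<open>c\<close> is at most the squared norm of
  \<open>x\<close>.\<close>

lemma Mz_contractive: "contractive_tuple V (Mz :: 'd \<Rightarrow> _)"
proof -
  note adj = V.adj_props[OF V.ips_axioms Mz_bounded, simplified]
  note adj_linear = V.adj_linear[OF V.ips_axioms Mz_bounded, simplified]
  define B where "B x = (\<Sum>i\<in>UNIV. Mz i (adj V V (Mz i) x))" for x
  have B_in: "B x \<in> S" if "x \<in> S" for x
    unfolding B_def using V.sum_in[of UNIV "\<lambda>i. Mz i (adj V V (Mz i) x)"] that adj(1) Mz_S by simp
  have B_add: "B (x + y) = B x + B y" if "x \<in> S" "y \<in> S" for x y
    unfolding B_def using that by (simp add: adj_linear Mz_add sum.distrib)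
  have B_scale: "B (a *\<^sub>C x) = a *\<^sub>C B x" if "x \<in> S" for x a
    unfolding B_def using that by (simp add: adj_linear Mz_scale complex_vector.scale_sum_right)
  have ip_B: "ip H (B x) x = of_real (\<Sum>i\<in>UNIV. (nrm H (adj V V (Mz i) x))\<^sup>2)" if x: "x \<in> S" for x
  proof -
    have "ip H (B x) x = (\<Sum>i\<in>UNIV. ip H (Mz i (adj V V (Mz i) x)) x)"
      unfolding B_def using x adj(1) Mz_S S_elts by (intro ip_sum_left) auto
    also have "\<dots> = (\<Sum>i\<in>UNIV. ip H (adj V V (Mz i) x) (adj V V (Mz i) x))"
      using x adj by simp
    also have "\<dots> = (\<Sum>i\<in>UNIV. of_real ((nrm H (adj V V (Mz i) x))\<^sup>2))"
      using x adj(1) S_elts by (intro sum.cong refl ip_self) blast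
    finally show ?thesis
      by simp
  qed
  have B_sq: "(nrm H (B x))\<^sup>2 \<le> (\<Sum>i\<in>UNIV. (nrm H (adj V V (Mz i) x))\<^sup>2)" if "x \<in> S" for x
    unfolding B_def using that adj(1) S_elts by (intro row_contraction(2)) blast
  have B_le: "(\<Sum>i\<in>UNIV. (nrm H (adj V V (Mz i) x))\<^sup>2) \<le> (nrm H x)\<^sup>2" if x: "x \<in> S" for x
  proof -
    define c where "c = (\<Sum>i\<in>UNIV. (nrm H (adj V V (Mz i) x))\<^sup>2)"
    have "0 \<le> c"
      by (simp add: c_def sum_nonneg)
    have "c \<le> cmod (ip H (B x) x)"
      unfolding ip_B[OF x] c_def[symmetric] by simp
    also have "\<dots> \<le> nrm H (B x) * nrm H x"
      using x B_in S_elts by (intro Cauchy_Schwarz) auto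
    finally have "c\<^sup>2 \<le> (nrm H (B x))\<^sup>2 * (nrm H x)\<^sup>2"
      using \<open>0 \<le> c\<close> by (simp add: power_mono flip: power_mult_distrib)
    also have "\<dots> \<le> c * (nrm H x)\<^sup>2"
      using B_sq[OF x] by (intro mult_right_mono) (auto simp: c_def)
    finally have "c \<le> (nrm H x)\<^sup>2"
      using \<open>0 \<le> c\<close> by (cases "c = 0") (auto simp: power2_eq_square)
    then show ?thesis
      by (simp add: c_def)
  qed
  have B_nrm: "nrm H (B x) \<le> nrm H x" if "x \<in> S" for x
    using order_trans[OF B_sq B_le] that B_in S_elts by (auto intro: power2_le_imp_le)
  have "bounded_op V V (\<lambda>x. x - B x)"
    unfolding bounded_op_def
  proof (intro conjI ballI allI exI)
    fix x y a assume x: "x \<in> elts V"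
    then have xS: "x \<in> S"
      by simp
    then show "x - B x \<in> elts V"
      using V.diff_in[of x "B x"] B_in by simp
    show "a *\<^sub>C x - B (a *\<^sub>C x) = a *\<^sub>C (x - B x)"
      using xS by (simp add: B_scale complex_vector.scale_right_diff_distrib)
    have xH: "B x \<in> elts H" "x \<in> elts H"
      using xS B_in S_elts by auto
    note mB = scale_in[OF xH(1), of "-1"] xH
    have "nrm H (x + (-1) *\<^sub>C B x) \<le> nrm H x + nrm H ((-1) *\<^sub>C B x)"
      using mB by (intro nrm_triangle)
    also have "\<dots> \<le> 2 * nrm H x"
      using mB B_nrm[OF xS] by (simp only: nrm_scale) simp
    finally show "nrm V (x - B x) \<le> 2 * nrm V x"
      by simp
    assume "y \<in> elts V"
    then show "x + y - B (x + y) = x - B x + (y - B y)"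
      using xS by (simp add: B_add)
  qed
  moreover have "ip V (x - B x) x \<in> \<real>\<^sub>\<ge>\<^sub>0" if "x \<in> elts V" for x
  proof -
    have x: "x \<in> S" "x \<in> elts H" "B x \<in> elts H"
      using that S_elts B_in by auto
    have "ip H (x - B x) x = of_real ((nrm H x)\<^sup>2 - (\<Sum>i\<in>UNIV. (nrm H (adj V V (Mz i) x))\<^sup>2))"
      using x by (simp only: ip_diff_left ip_self ip_B of_real_diff)
    then show ?thesis
      using B_le[OF x(1)] by (simp del: of_real_diff)
  qed
  ultimately have "positive_op V (\<lambda>x. x - B x)"
    by (simp add: positive_op_def)
  then show ?thesis
    unfolding contractive_tuple_def using Mz_bounded by (simp add: Psi_def B_def)
qed

section \<open>The reproducing kernel of the submodule\<close>

lemma ex_kernel_S: "\<exists>k\<in>S. \<forall>f\<in>S. ip H f k = f l"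
proof -
  \<comment> \<open>The kernel function of \<open>S\<close> at \<open>l\<close> is the projection of
    that of \<open>H\<close>.\<close>
  obtain v where v: "v \<in> closure_in H S" "\<And>f. f \<in> S \<Longrightarrow> ip H f (DA_kernel l - v) = 0"
    using ex_projection[of S "DA_kernel l"] S_closed by (auto simp: closed_csubspace_def)
  then have "v \<in> S"
    using S_closed by (auto simp: closed_csubspace_def)
  moreover have "ip H f v = f l" if "f \<in> S" for f
    using v(2)[OF that] that \<open>v \<in> S\<close> S_elts by (simp add: ip_diff_right ip_kernel)
  ultimately show ?thesis
    by blast
qed

definition kS :: "'d unit_ball \<Rightarrow> 'd unit_ball \<Rightarrow> complex" where
  "kS l = (SOME k. k \<in> S \<and> (\<forall>f\<in>S. ip H f k = f l))"

lemma kS_in: "kS l \<in> S" and ip_kS: "f \<in> S \<Longrightarrow> ip H f (kS l) = f l"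
  using someI_ex[OF ex_kernel_S[of l, unfolded Bex_def]] by (auto simp: kS_def)

end

locale da_finite_defect = da_submodule H S for H :: "('d::finite unit_ball \<Rightarrow> complex) ip_space" and S +
  assumes Delta_finite: "Delta (H\<lparr>elts := S\<rparr>) (Mz :: 'd \<Rightarrow> _) 1 < \<infinity>"
begin

sublocale V: finite_defect "H\<lparr>elts := S\<rparr>" "Mz :: 'd \<Rightarrow> _"
  using V.hilbert_axioms Mz_contractive Delta_finite
  by (simp add: finite_defect_def finite_defect_axioms_def)

lemma adj_Mz_kS: "V.Ta i (kS l) = cnj (vec_of l $ i) *\<^sub>C kS l"
proof (rule V.ip_ext)
  have k: "kS l \<in> elts V"
    by (simp add: kS_in)
  show "V.Ta i (kS l) \<in> elts V" "cnj (vec_of l $ i) *\<^sub>C kS l \<in> elts V"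
    using V.Ta_in[OF k] V.scale_in[OF k] by auto
  fix w assume w: "w \<in> elts V"
  have "ip V w (V.Ta i (kS l)) = ip V (Mz i w) (kS l)"
    by (rule V.ip_Ta[OF w k])
  also have "\<dots> = vec_of l $ i * w l"
    using w by (simp add: ip_kS Mz_S) (simp add: Mz_def)
  also have "\<dots> = ip V w (cnj (vec_of l $ i) *\<^sub>C kS l)"
    using w k V.ip_scale_right[OF w k] by (simp add: ip_kS)
  finally show "ip V w (V.Ta i (kS l)) = ip V w (cnj (vec_of l $ i) *\<^sub>C kS l)" .
qed

text \<open>The kernel functions are eigenvectors of the adjoints, so applying \<open>A\<close>
  multiplies \<open>kS l m\<close> by \<open>1 - sp m l\<close>. The result is also
  \<open>ip V (D (kS l)) (D (kS m))\<close>, which is expanded along \<open>E\<close>;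
  multiplication by the kernel of \<open>H\<close> then removes the factor.\<close>

lemma kS_factorization: "kS l m = (\<Sum>e\<in>V.E. cnj (V.D e l) * V.D e m) * DA_kernel l m"
proof -
  have k: "kS l \<in> elts V" for l
    by (simp add: kS_in)
  have ip_k: "ip V f (kS l) = f l" if "f \<in> elts V" for f l
    using that by (simp add: ip_kS)
  have ip_k': "ip V (kS l) f = cnj (f l)" if "f \<in> elts V" for f l
    using V.ip_sym[OF that k[of l]] ip_k[OF that] by simp
  have "(1 - sp m l) * kS l m = V.A (kS l) m"
    by (simp add: V.A_eq adj_Mz_kS fun_sum_apply Mz_def sp_def scaleC_fun_def scaleC_complex_def
        right_diff_distrib sum_distrib_left mult_ac)
  also have "\<dots> = ip V (V.D (kS l)) (V.D (kS m))"
    using V.D_selfadjoint[OF V.D_in[OF k] k, of l m] ip_k[OF V.A_in[OF k], of l m] V.DD[OF k, of l]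
    by simp
  also have "\<dots> = (\<Sum>e\<in>V.E. ip V (ip V (kS l) (V.D e) *\<^sub>C e) (V.D (kS m)))"
    unfolding V.D_expansion[OF k, of l]
    by (rule V.ip_sum_left) (intro V.scale_in V.E_elts V.D_in k, assumption?)+
  also have "\<dots> = (\<Sum>e\<in>V.E. cnj (V.D e l) * V.D e m)"
  proof (intro sum.cong refl)
    fix e assume e: "e \<in> V.E"
    note eV = V.E_elts[OF e]
    show "ip V (ip V (kS l) (V.D e) *\<^sub>C e) (V.D (kS m)) = cnj (V.D e l) * V.D e m"
      using V.D_selfadjoint[OF eV k, of m] ip_k[OF V.D_in[OF eV], of m]
      by (simp only: V.ip_scale_left[OF eV V.D_in[OF k]] ip_k'[OF V.D_in[OF eV]])
  qed
  finally have "(1 - sp m l) * DA_kernel l m * kS l m = (\<Sum>e\<in>V.E. cnj (V.D e l) * V.D e m) * DA_kernel l m"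
    by (simp add: mult_ac)
  then show ?thesis
    by (simp add: DA_kernel_sp)
qed

section \<open>The products \<open>z^a * D e\<close> and the dimension count\<close>

definition idx :: "nat \<Rightarrow> (('d \<Rightarrow> nat) \<times> ('d unit_ball \<Rightarrow> complex)) set" where
  "idx n = {a. sum a UNIV < n} \<times> V.E"

text \<open>Pairs serve as indices because the maximality condition counts pairs; two pairs with the
  same product already violate independence.\<close>

definition fam :: "('d \<Rightarrow> nat) \<times> ('d unit_ball \<Rightarrow> complex) \<Rightarrow> 'd unit_ball \<Rightarrow> complex" where
  "fam = (\<lambda>(a, e). mono_fun a * V.D e)"

lemma finite_idx: "finite (idx n)"
  by (simp add: idx_def card_weight_less)

lemma card_idx: "card (idx n) = (\<Sum>k<n. (k + CARD('d) - 1) choose (CARD('d) - 1)) * card V.E"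
  by (simp add: idx_def card_cartesian_product card_weight_less)

lemma Mz_fam: "Mz i (fam (a, e)) = fam (a(i := Suc (a i)), e)"
  by (simp add: fam_def mono_fun_Suc) (simp add: Mz_def fun_eq_iff mult_ac)

text \<open>Coordinate multiplications commute, so words of length below \<open>n\<close> reduce to
  multi-indices of weight below \<open>n\<close>, and a multi-index of positive weight is one
  coordinate step above another.\<close>

lemma G_eq: "V.G n = fam ` idx n"
proof (induction n)
  case 0
  then show ?case
    by (simp add: idx_def)
next
  case (Suc n)
  have D: "V.D e = fam (\<lambda>_. 0, e)" for e
    by (simp add: fam_def mono_fun_0)
  show ?case
  proof (intro equalityI subsetI)
    fix f assume "f \<in> V.G (Suc n)"
    then consider e where "e \<in> V.E" "f = V.D e" | i a e where "(a, e) \<in> idx n" "f = Mz i (fam (a, e))"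
      using Suc by auto
    then show "f \<in> fam ` idx (Suc n)"
    proof cases
      case (1 e)
      then show ?thesis
        by (auto simp: D idx_def intro!: image_eqI[of _ _ "(\<lambda>_. 0, e)"])
    next
      case (2 i a e)
      then have "(a(i := Suc (a i)), e) \<in> idx (Suc n)"
        by (simp add: idx_def weight_Suc del: fun_upd_apply)
      then show ?thesis
        using 2 by (simp add: Mz_fam)
    qed
  next
    fix f assume "f \<in> fam ` idx (Suc n)"
    then obtain a e where ae: "sum a UNIV < Suc n" "e \<in> V.E" "f = fam (a, e)"
      by (auto simp: idx_def)
    show "f \<in> V.G (Suc n)"
    proof (cases "sum a UNIV")
      case 0
      then have "a = (\<lambda>_. 0)"
        by auto
      then show ?thesis
        using ae by (auto simp: D)
    next
      case (Suc k)
      then obtain b i where b: "a = b(i := Suc (b i))" "sum b UNIV = k"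
        by (rule weight_SucE)
      then have "fam (b, e) \<in> V.G n" "f = Mz i (fam (b, e))"
        using ae Suc Suc.IH by (auto simp: idx_def Mz_fam)
      then show ?thesis
        by auto
    qed
  qed
qed

lemma Delta_eq: "Delta V Mz n = edim (cspan (fam ` idx n))"
  unfolding Delta_def by (simp add: V.defect_space_eq_cspan G_eq)

text \<open>The family indexed by \<open>idx n\<close> spans the \<open>n\<close>-th defect space,
  so \<open>card (idx n)\<close> is the largest value that \<open>Delta\<close> can take there;
  attaining it means independence.\<close>

lemma maximal_iff:
  "maximal_submodule H S \<longleftrightarrow>
    (\<forall>n c. (\<Sum>j\<in>idx n. c j *\<^sub>C fam j) = 0 \<longrightarrow> (\<forall>j\<in>idx n. c j = 0))"
proof -
  have "maximal_submodule H S \<longleftrightarrow> (\<forall>n\<ge>1. Delta V Mz n =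
      of_nat (\<Sum>k<n. (k + CARD('d) - 1) choose (CARD('d) - 1)) * enat (card V.E))"
    unfolding maximal_submodule_def maximal_tuple_def V.Delta_1
    using Mz_commuting Mz_contractive by (simp del: One_nat_def)
  also have "\<dots> \<longleftrightarrow> (\<forall>n\<ge>1. edim (cspan (fam ` idx n)) = enat (card (idx n)))"
    by (simp only: Delta_eq card_idx of_nat_eq_enat times_enat_simps)
  also have "\<dots> \<longleftrightarrow> (\<forall>n\<ge>1. \<forall>c. (\<Sum>j\<in>idx n. c j *\<^sub>C fam j) = 0 \<longrightarrow> (\<forall>j\<in>idx n. c j = 0))"
    by (simp only: edim_cspan_family[OF finite_idx])
  also have "\<dots> \<longleftrightarrow> (\<forall>n c. (\<Sum>j\<in>idx n. c j *\<^sub>C fam j) = 0 \<longrightarrow> (\<forall>j\<in>idx n. c j = 0))"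
  proof -
    \<comment> \<open>Maximality speaks of \<open>n \<ge> 1\<close>; over the empty index set the
      statement for \<open>n = 0\<close> is trivial and can be added.\<close>
    have "idx 0 = {}"
      by (simp add: idx_def)
    then have "(\<Sum>j\<in>idx n. c j *\<^sub>C fam j) = 0 \<longrightarrow> (\<forall>j\<in>idx n. c j = 0)" if "\<not> n \<ge> 1" for n c
      using that by (cases n) auto
    then show ?thesis
      by blast
  qed
  finally show ?thesis .
qed

end

section \<open>The adjoint of the Poisson kernel\<close>

locale da_poisson = da_finite_defect H S
  for H :: "('d::finite unit_ball \<Rightarrow> complex) ip_space" and S +
  fixes U :: "'u::complex_vector ip_space"
    and tens :: "('d unit_ball \<Rightarrow> complex) \<Rightarrow> ('d unit_ball \<Rightarrow> complex) \<Rightarrow> 'u"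
  assumes tensor: "is_hilbert_tensor H (H\<lparr>elts := V.D1\<rparr>) U tens"
begin

sublocale U: hilbert U
  using tensor by (intro hilbertI) (simp add: is_hilbert_tensor_def)

lemma tens_in [simp]: "f \<in> elts H \<Longrightarrow> x \<in> V.D1 \<Longrightarrow> tens f x \<in> elts U"
  and tens_add_left: "f \<in> elts H \<Longrightarrow> g \<in> elts H \<Longrightarrow> x \<in> V.D1 \<Longrightarrow> tens (f + g) x = tens f x + tens g x"
  and tens_add_right: "f \<in> elts H \<Longrightarrow> x \<in> V.D1 \<Longrightarrow> y \<in> V.D1 \<Longrightarrow> tens f (x + y) = tens f x + tens f y"
  and tens_scale_left: "f \<in> elts H \<Longrightarrow> x \<in> V.D1 \<Longrightarrow> tens (a *\<^sub>C f) x = a *\<^sub>C tens f x"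
  and tens_scale_right: "f \<in> elts H \<Longrightarrow> x \<in> V.D1 \<Longrightarrow> tens f (a *\<^sub>C x) = a *\<^sub>C tens f x"
  and ip_tens: "f \<in> elts H \<Longrightarrow> g \<in> elts H \<Longrightarrow> x \<in> V.D1 \<Longrightarrow> y \<in> V.D1 \<Longrightarrow>
    ip U (tens f x) (tens g y) = ip H f g * ip H x y"
  using tensor unfolding is_hilbert_tensor_def elts_update ip_update by blast+

lemma E_ip: "e \<in> V.E \<Longrightarrow> e' \<in> V.E \<Longrightarrow> ip H e e' = (if e = e' then 1 else 0)"
  using V.E_orthonormal by (simp add: V.orthonormal_def)

text \<open>The kernel of \<open>S\<close> is factored through \<open>U\<close>: the vectors \<open>bU l\<close> have the same Gram matrix as the
  kernel functions \<open>kS l\<close>, so \<open>kS l \<mapsto> bU l\<close> extends to an isometry, whose adjoint is the map \<open>P\<close> below.\<close>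

definition bU :: "'d unit_ball \<Rightarrow> 'u" where
  "bU l = (\<Sum>e\<in>V.E. cnj (V.D e l) *\<^sub>C tens (DA_kernel l) e)"

lemma bU_in: "bU l \<in> elts U"
  unfolding bU_def by (intro U.sum_in U.scale_in tens_in kernel_in V.E_D1)

text \<open>Pairing with \<open>bU l\<close> evaluates \<open>f * D x\<close> at \<open>l\<close>:
  the first factor uses the reproducing property, the second the expansion of \<open>x\<close> along
  \<open>E\<close>.\<close>

lemma ip_tens_bU:
  assumes f: "f \<in> elts H" and x: "x \<in> V.D1"
  shows "ip U (tens f x) (bU l) = f l * V.D x l"
proof -
  have "ip U (tens f x) (bU l) = (\<Sum>e\<in>V.E. V.D e l * (f l * ip H x e))"
  proof -
    have "ip U (tens f x) (bU l) = (\<Sum>e\<in>V.E. ip U (tens f x) (cnj (V.D e l) *\<^sub>C tens (DA_kernel l) e))"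
      unfolding bU_def using f x V.E_D1 by (intro U.ip_sum_right U.scale_in tens_in kernel_in)
    also have "\<dots> = (\<Sum>e\<in>V.E. V.D e l * (f l * ip H x e))"
      using f x V.E_D1 by (intro sum.cong refl) (simp add: U.ip_scale_right ip_tens ip_kernel del: One_nat_def)
    finally show ?thesis .
  qed
  moreover have "V.D x = (\<Sum>e\<in>V.E. ip H x e *\<^sub>C V.D e)"
  proof -
    have "V.D x = V.D (\<Sum>e\<in>V.E. ip H x e *\<^sub>C e)"
      using V.D1_expansion[OF x] by simp
    also have "\<dots> = (\<Sum>e\<in>V.E. V.D (ip H x e *\<^sub>C e))"
      by (intro V.D_sum V.scale_in V.E_elts)
    also have "\<dots> = (\<Sum>e\<in>V.E. ip H x e *\<^sub>C V.D e)"
      using V.D_scale[OF V.E_elts] by simp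
    finally show ?thesis .
  qed
  then have "V.D x l = (\<Sum>e\<in>V.E. ip H x e * V.D e l)"
    by (metis (no_types, lifting) fun_sum_apply scaleC_fun_def scaleC_complex_def sum.cong)
  ultimately show ?thesis
    by (simp add: sum_distrib_left mult_ac)
qed

text \<open>The kernel factorization, read as an inner product in the tensor product.\<close>

lemma Gram_bU: "ip U (bU l) (bU m) = ip H (kS l) (kS m)"
proof -
  have "ip U (bU l) (bU m) = (\<Sum>e\<in>V.E. ip U (cnj (V.D e l) *\<^sub>C tens (DA_kernel l) e) (bU m))"
    unfolding bU_def[of l] using V.E_D1 bU_in by (intro U.ip_sum_left U.scale_in tens_in kernel_in)
  also have "\<dots> = (\<Sum>e\<in>V.E. cnj (V.D e l) * (DA_kernel l m * V.D e m))"
    using V.E_D1 bU_in by (intro sum.cong refl) (simp add: U.ip_scale_left ip_tens_bU del: One_nat_def)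
  also have "\<dots> = kS l m"
    by (simp add: kS_factorization sum_distrib_left sum_distrib_right mult_ac)
  finally show ?thesis
    by (simp add: ip_kS kS_in)
qed

text \<open>Equal Gram matrices make combinations of the \<open>bU l\<close> and of the
  \<open>kS l\<close> equally long. Cauchy-Schwarz in \<open>U\<close> therefore gives the bound
  that \<open>Riesz_family\<close> needs in \<open>S\<close>.\<close>

lemma P_exists:
  assumes u: "u \<in> elts U"
  shows "(\<lambda>l. ip U u (bU l)) \<in> elts H" "nrm H (\<lambda>l. ip U u (bU l)) \<le> nrm U u"
proof -
  have bd: "cmod (\<Sum>l\<in>I. c l * ip U (bU l) u) \<le> nrm U u * nrm V (\<Sum>l\<in>I. c l *\<^sub>C kS l)" for I c
  proof -
    have bI: "(\<Sum>l\<in>I. c l *\<^sub>C bU l) \<in> elts U"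
      by (intro U.sum_in U.scale_in bU_in)
    have "(\<Sum>l\<in>I. c l * ip U (bU l) u) = ip U (\<Sum>l\<in>I. c l *\<^sub>C bU l) u"
      using u bU_in by (subst U.ip_sum_left) (auto simp: U.ip_scale_left)
    also have "cmod \<dots> \<le> nrm U (\<Sum>l\<in>I. c l *\<^sub>C bU l) * nrm U u"
      by (rule U.Cauchy_Schwarz[OF bI u])
    also have "nrm U (\<Sum>l\<in>I. c l *\<^sub>C bU l) = nrm H (\<Sum>l\<in>I. c l *\<^sub>C kS l)"
      unfolding nrm_def by (simp add: U.ip_sum_sum bU_in ip_sum_sum S_elts kS_in Gram_bU)
    finally show ?thesis
      by (simp add: mult.commute)
  qed
  have "\<exists>v\<in>elts V. nrm V v \<le> nrm U u \<and> (\<forall>l. ip V (kS l) v = ip U (bU l) u)"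
    by (rule V.Riesz_family) (use u bd kS_in in auto)
  then obtain v where v: "v \<in> S" "nrm H v \<le> nrm U u" "\<And>l. ip H (kS l) v = ip U (bU l) u"
    by auto
  have "v l = ip U u (bU l)" for l
    using ip_sym[OF S_elts[OF kS_in] S_elts[OF v(1)], of l] U.ip_sym[OF bU_in u, of l] v(3)[of l] v(1)
    by (simp add: ip_kS)
  then have "v = (\<lambda>l. ip U u (bU l))"
    by blast
  then show "(\<lambda>l. ip U u (bU l)) \<in> elts H" "nrm H (\<lambda>l. ip U u (bU l)) \<le> nrm U u"
    using v S_elts by auto
qed

abbreviation "P \<equiv> poisson_adj H S U tens"

text \<open>Pairing with \<open>bU\<close> is the witness for the \<open>SOME\<close> in
  \<open>poisson_adj\<close>. What passes from the witness to \<open>P\<close> is boundedness and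
  the values on polynomial tensors.\<close>

lemma P_bounded: "bounded_op U H P"
  and P_tens: "p \<in> polys \<Longrightarrow> x \<in> V.D1 \<Longrightarrow> P (tens p x) = p * V.D x"
proof -
  define R where "R u = (\<lambda>l. ip U u (bU l))" for u
  have "bounded_op U H R"
    unfolding bounded_op_def
    by (auto simp: R_def P_exists U.ip_add_left U.ip_scale_left bU_in fun_eq_iff scaleC_fun_def
        scaleC_complex_def intro!: exI[of _ 1])
  moreover have "R (tens p x) = p * V.D x" if "p \<in> polys" "x \<in> V.D1" for p x
    using that polys_subset by (auto simp: R_def ip_tens_bU fun_eq_iff simp del: One_nat_def)
  ultimately have "\<exists>R. bounded_op U H R \<and> (\<forall>p\<in>polys. \<forall>x\<in>V.D1. R (tens p x) = p * V.D x)"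
    by blast
  from someI_ex[OF this]
  show "bounded_op U H P" "p \<in> polys \<Longrightarrow> x \<in> V.D1 \<Longrightarrow> P (tens p x) = p * V.D x"
    unfolding poisson_adj_def by blast+
qed

lemma P_add: "u \<in> elts U \<Longrightarrow> v \<in> elts U \<Longrightarrow> P (u + v) = P u + P v"
  and P_scale: "u \<in> elts U \<Longrightarrow> P (a *\<^sub>C u) = a *\<^sub>C P u"
  using P_bounded by (auto simp: bounded_op_def)

lemma P_0: "P 0 = 0"
  using P_scale[of 0 0] by simp

lemma P_sum: "(\<And>i. i \<in> I \<Longrightarrow> f i \<in> elts U) \<Longrightarrow> P (\<Sum>i\<in>I. f i) = (\<Sum>i\<in>I. P (f i))"
  by (induction I rule: infinite_finite_induct) (auto simp: P_0 P_add U.sum_in)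

section \<open>Polynomials with values in the first defect space\<close>

lemma mono_fun_polys: "mono_fun a \<in> polys"
  unfolding polys_eq by (rule complex_vector.span_base) simp

definition famU :: "('d \<Rightarrow> nat) \<times> ('d unit_ball \<Rightarrow> complex) \<Rightarrow> 'u" where
  "famU = (\<lambda>(a, e). tens (mono_fun a) e)"

lemma famU_in: "j \<in> UNIV \<times> V.E \<Longrightarrow> famU j \<in> elts U"
  by (auto simp: famU_def mono_fun_in V.E_D1 simp del: One_nat_def)

lemma P_famU: "j \<in> UNIV \<times> V.E \<Longrightarrow> P (famU j) = fam j"
  by (auto simp: famU_def fam_def P_tens mono_fun_polys V.E_D1 simp del: One_nat_def)

lemma idx_subset: "idx n \<subseteq> UNIV \<times> V.E"
  by (auto simp: idx_def)

lemma P_sum_famU: "P (\<Sum>j\<in>idx n. c j *\<^sub>C famU j) = (\<Sum>j\<in>idx n. c j *\<^sub>C fam j)"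
proof -
  have "P (\<Sum>j\<in>idx n. c j *\<^sub>C famU j) = (\<Sum>j\<in>idx n. P (c j *\<^sub>C famU j))"
    using idx_subset famU_in by (intro P_sum U.scale_in) blast
  also have "\<dots> = (\<Sum>j\<in>idx n. c j *\<^sub>C fam j)"
  proof (intro sum.cong refl)
    fix j assume "j \<in> idx n"
    with idx_subset have "j \<in> UNIV \<times> V.E"
      by (rule subsetD)
    then show "P (c j *\<^sub>C famU j) = c j *\<^sub>C fam j"
      by (simp only: P_scale[OF famU_in] P_famU)
  qed
  finally show ?thesis .
qed

text \<open>Bilinearity reduces the first factor to monomials and the second to the basis
  \<open>E\<close>.\<close>

lemma polys_tens_subset: "{tens p x | p x. p \<in> polys \<and> x \<in> V.D1} \<subseteq> cspan (famU ` (UNIV \<times> V.E))"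
proof clarify
  fix p :: "'d unit_ball \<Rightarrow> complex" and x
  assume p: "p \<in> polys" and x: "x \<in> V.D1"
  have e: "tens p e \<in> cspan (famU ` (UNIV \<times> V.E))" if e: "e \<in> V.E" for e
  proof -
    have "p \<in> elts H \<and> tens p e \<in> cspan (famU ` (UNIV \<times> V.E))"
      using p unfolding polys_eq
    proof (induction rule: complex_vector.span_induct_alt)
      case base
      have "tens 0 e = 0"
        using tens_scale_left[OF zero_in V.E_D1[OF e], of 0] by simp
      then show ?case
        by (simp only: zero_in complex_vector.span_zero simp_thms)
    next
      case (step c f g)
      then obtain a where f: "f = mono_fun a"
        by auto
      have "famU (a, e) \<in> cspan (famU ` (UNIV \<times> V.E))"
        using e by (intro complex_vector.span_base) auto
      then have "tens f e \<in> cspan (famU ` (UNIV \<times> V.E))"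
        by (simp only: f famU_def prod.case)
      moreover have "tens (c *\<^sub>C f + g) e = c *\<^sub>C tens f e + tens g e"
        using step(2) V.E_D1[OF e]
        by (simp only: f tens_add_left tens_scale_left mono_fun_in scale_in)
      ultimately show ?case
        using step(2)
        by (simp only: f mono_fun_in scale_in add_in complex_vector.span_add complex_vector.span_scale simp_thms)
    qed
    then show ?thesis ..
  qed
  have pH: "p \<in> elts H"
    using p polys_subset by blast
  have "tens p (\<Sum>e\<in>F. c e *\<^sub>C e) = (\<Sum>e\<in>F. c e *\<^sub>C tens p e) \<and> (\<Sum>e\<in>F. c e *\<^sub>C e) \<in> V.D1"
    if "finite F" "F \<subseteq> V.E" for F c
    using that
  proof (induction F)
    case empty
    have 0: "0 \<in> V.D1"
      using V.D1_subspace by (rule complex_vector.subspace_0)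
    moreover have "tens p 0 = 0"
      using tens_scale_right[OF pH 0, of 0] by simp
    ultimately show ?case
      by (simp only: sum.empty simp_thms)
  next
    case (insert e F)
    then have "e \<in> V.D1" "c e *\<^sub>C e \<in> V.D1" "(\<Sum>e\<in>F. c e *\<^sub>C e) \<in> V.D1"
      using V.E_D1 complex_vector.subspace_scale[OF V.D1_subspace] by auto
    then show ?case
      using insert pH complex_vector.subspace_add[OF V.D1_subspace]
      by (simp only: sum.insert tens_add_right tens_scale_right insert_subset simp_thms)
  qed
  from this[OF V.finite_E order_refl, of "ip H x"]
  have "tens p x = (\<Sum>e\<in>V.E. ip H x e *\<^sub>C tens p e)"
    using V.D1_expansion[OF x] by simp
  then show "tens p x \<in> cspan (famU ` (UNIV \<times> V.E))"
    using e by (simp add: complex_vector.span_sum complex_vector.span_scale)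
qed

lemma cspan_polys_tensE:
  assumes "u \<in> cspan {tens p x | p x. p \<in> polys \<and> x \<in> V.D1}"
  obtains n c where "u = (\<Sum>j\<in>idx n. c j *\<^sub>C famU j)"
proof -
  have "u \<in> cspan (famU ` (UNIV \<times> V.E))"
    using assms complex_vector.span_minimal[OF polys_tens_subset complex_vector.subspace_span] by blast
  then obtain t r where t: "finite t" "t \<subseteq> famU ` (UNIV \<times> V.E)" and u: "u = (\<Sum>v\<in>t. r v *\<^sub>C v)"
    by (auto simp: complex_vector.span_explicit)
  \<comment> \<open>One index is chosen for each vector of \<open>t\<close>, so that the sum can be
    reindexed.\<close>
  obtain J where J: "J \<subseteq> UNIV \<times> V.E" "finite J" "t = famU ` J" "inj_on famU J"
    using t subset_image_inj[of t famU] finite_image_iff by metis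
  \<comment> \<open>A bound beyond the weights of all multi-indices in \<open>J\<close>, so that one
    \<open>idx n\<close> contains them.\<close>
  define n where "n = Suc (\<Sum>j\<in>J. sum (fst j) UNIV)"
  have "J \<subseteq> idx n"
  proof
    fix j assume j: "j \<in> J"
    have "sum (fst j) UNIV \<le> (\<Sum>j\<in>J. sum (fst j) UNIV)"
      using j J by (intro member_le_sum[of j J "\<lambda>j. sum (fst j) UNIV"]) auto
    then show "j \<in> idx n"
      using j J by (auto simp: idx_def n_def)
  qed
  define c where "c j = (if j \<in> J then r (famU j) else 0)" for j
  have "u = (\<Sum>j\<in>J. r (famU j) *\<^sub>C famU j)"
    using u J by (simp add: sum.reindex)
  also have "\<dots> = (\<Sum>j\<in>idx n. c j *\<^sub>C famU j)"
    using \<open>J \<subseteq> idx n\<close> finite_idx by (intro sum.mono_neutral_cong_left) (auto simp: c_def)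
  finally show thesis
    by (rule that)
qed

text \<open>Let \<open>g\<close> be the polynomial formed by the coefficients at \<open>e\<close>.
  Testing the relation against \<open>tens g e\<close> picks out exactly these coefficients and
  yields \<open>ip H g g = 0\<close>; independence of the monomials does the rest.\<close>

lemma famU_independent:
  assumes rel: "(\<Sum>j\<in>idx n. c j *\<^sub>C famU j) = 0" and j: "j \<in> idx n"
  shows "c j = 0"
proof -
  define F where "F = {a :: 'd \<Rightarrow> nat. sum a UNIV < n}"
  have F: "finite F"
    by (simp add: F_def card_weight_less)
  obtain b e where be: "j = (b, e)" "b \<in> F" "e \<in> V.E"
    using j by (auto simp: idx_def F_def)
  define g where "g = (\<Sum>a\<in>F. c (a, e) *\<^sub>C mono_fun a)"
  have gH: "g \<in> elts H"
    unfolding g_def by (intro sum_in scale_in mono_fun_in)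
  have eD: "e \<in> V.D1"
    using be V.E_D1 by blast
  have "0 = ip U (\<Sum>j\<in>idx n. c j *\<^sub>C famU j) (tens g e)"
    using rel gH eD by simp
  also have "\<dots> = (\<Sum>j\<in>idx n. c j * ip U (famU j) (tens g e))"
    using idx_subset famU_in gH eD
    by (subst U.ip_sum_left) (auto simp: U.ip_scale_left subset_iff simp del: One_nat_def intro!: sum.cong)
  also have "\<dots> = (\<Sum>a\<in>F. \<Sum>e'\<in>V.E. c (a, e') * ip U (famU (a, e')) (tens g e))"
    by (simp add: idx_def F_def sum.cartesian_product)
  also have "\<dots> = (\<Sum>a\<in>F. \<Sum>e'\<in>V.E. if e' = e then c (a, e) * ip H (mono_fun a) g else 0)"
    using gH eD be V.E_D1
    by (intro sum.cong refl) (simp add: famU_def ip_tens mono_fun_in E_ip del: One_nat_def)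
  also have "\<dots> = (\<Sum>a\<in>F. c (a, e) * ip H (mono_fun a) g)"
    using be by simp
  also have "\<dots> = ip H g g"
  proof -
    have "ip H g g = ip H (\<Sum>a\<in>F. c (a, e) *\<^sub>C mono_fun a) g"
      by (simp only: g_def)
    also have "\<dots> = (\<Sum>a\<in>F. c (a, e) * ip H (mono_fun a) g)"
      using gH by (subst ip_sum_left) (auto simp: mono_fun_in ip_scale_left)
    finally show ?thesis ..
  qed
  finally have "g = 0"
    using gH by (simp add: ip_self_eq_0)
  then show ?thesis
    using mono_fun_independent[OF F, of "\<lambda>a. c (a, e)" b] be by (simp add: g_def)
qed

text \<open>\<open>P\<close> carries a combination of the \<open>famU j\<close> to that of the
  \<open>fam j\<close> with the same coefficients. As the \<open>famU j\<close> are independent and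
  span the polynomial tensors, nonzero kernel elements among these tensors correspond to nontrivial
  relations among the \<open>fam j\<close>.\<close>

lemma maximal_iff_kernel_trivial:
  "maximal_submodule H S \<longleftrightarrow>
    cspan {tens p x | p x. p \<in> polys \<and> x \<in> V.D1} \<inter> {u \<in> elts U. P u = 0} = {0}"
  (is "_ \<longleftrightarrow> ?X \<inter> _ = _")
  unfolding maximal_iff
proof
  assume ind: "\<forall>n c. (\<Sum>j\<in>idx n. c j *\<^sub>C fam j) = 0 \<longrightarrow> (\<forall>j\<in>idx n. c j = 0)"
  have "u = 0" if u: "u \<in> ?X" "P u = 0" for u
  proof -
    obtain n c where c: "u = (\<Sum>j\<in>idx n. c j *\<^sub>C famU j)"
      using cspan_polys_tensE[OF u(1)] .
    then have "\<forall>j\<in>idx n. c j = 0"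
      using u(2) ind by (simp add: P_sum_famU)
    then show ?thesis
      by (simp add: c)
  qed
  then show "?X \<inter> {u \<in> elts U. P u = 0} = {0}"
    using P_0 complex_vector.span_zero by auto
next
  assume ker: "?X \<inter> {u \<in> elts U. P u = 0} = {0}"
  show "\<forall>n c. (\<Sum>j\<in>idx n. c j *\<^sub>C fam j) = 0 \<longrightarrow> (\<forall>j\<in>idx n. c j = 0)"
  proof (intro allI impI)
    fix n c assume rel: "(\<Sum>j\<in>idx n. c j *\<^sub>C fam j) = 0"
    have "famU j \<in> ?X" if j: "j \<in> idx n" for j
    proof (rule complex_vector.span_base)
      obtain a e where "j = (a, e)" "e \<in> V.E"
        using subsetD[OF idx_subset j] by (elim SigmaE)
      then show "famU j \<in> {tens p x | p x. p \<in> polys \<and> x \<in> V.D1}"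
        using mono_fun_polys V.E_D1 unfolding famU_def by auto
    qed
    then have "(\<Sum>j\<in>idx n. c j *\<^sub>C famU j) \<in> ?X"
      by (intro complex_vector.span_sum complex_vector.span_scale)
    moreover have "(\<Sum>j\<in>idx n. c j *\<^sub>C famU j) \<in> elts U"
      using idx_subset famU_in by (intro U.sum_in U.scale_in) blast
    ultimately have "(\<Sum>j\<in>idx n. c j *\<^sub>C famU j) = 0"
      using ker rel P_sum_famU[of c n] by (metis (mono_tags, lifting) IntI mem_Collect_eq singletonD)
    then show "\<forall>j\<in>idx n. c j = 0"
      by (intro ballI) (rule famU_independent)
  qed
qed

end

theorem theorem4p5:
  fixes H :: "('d::finite unit_ball \<Rightarrow> complex) ip_space"
    and S D1 :: "('d unit_ball \<Rightarrow> complex) set"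
    and U :: "'u::complex_vector ip_space"
    and tens :: "('d unit_ball \<Rightarrow> complex) \<Rightarrow> ('d unit_ball \<Rightarrow> complex) \<Rightarrow> 'u"
  assumes d: "CARD('d) \<ge> 2"
    and H: "is_drury_arveson H"
    and S: "submodule H S"
    and Delta_finite: "Delta (H\<lparr>elts := S\<rparr>) (Mz :: 'd \<Rightarrow> _) 1 < \<infinity>"
    and D1: "D1 = defect_space (H\<lparr>elts := S\<rparr>) (Mz :: 'd \<Rightarrow> _) 1"
    and U: "is_hilbert_tensor H (H\<lparr>elts := D1\<rparr>) U tens"
  shows "maximal_submodule H S \<longleftrightarrow>
    cspan {tens p x | p x. p \<in> polys \<and> x \<in> D1} \<inter> {u \<in> elts U. poisson_adj H S U tens u = 0} = {0}"
proof -
  have hilbert: "hilbert H"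
    using H by (intro hilbertI) (simp add: is_drury_arveson_def is_rkhs_def)
  interpret da_finite_defect H S
    using hilbert H S Delta_finite
    by (intro da_finite_defect.intro da_submodule.intro drury_arveson.intro drury_arveson_axioms.intro
        da_submodule_axioms.intro da_finite_defect_axioms.intro)
  interpret da_poisson H S U tens
    by unfold_locales (use U D1 in simp)
  show ?thesis
    unfolding D1 by (rule maximal_iff_kernel_trivial)
qed

end
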